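(* Let $f:\mathbb{R}^d\to\mathbb{R}$, let ${\bm{x}}^\star$ be a local minimizer of $f$ with $f$ twice differentiable in a neighborhood of ${\bm{x}}^\star$, and let ${\bm{H}}:=\nabla^2 f({\bm{x}}^\star)$ satisfy ${\bm{H}}\succeq 0$, ${\bm{H}}\neq{\bm{0}}$, with eigenvalues $\lambda_1\ge\cdots\ge\lambda_d\ge0$, $\lambda_{\max}({\bm{H}}):=\lambda_1$. Consider ZO-GDM with step size $\eta>0$, momentum $\beta\in[0,1)$ and smoothing parameter $\mu>0$ applied to $f_{\mathrm{quad}}({\bm{x}})=f({\bm{x}}^\star)+\tfrac12({\bm{x}}-{\bm{x}}^\star)^\top{\bm{H}}({\bm{x}}-{\bm{x}}^\star)$: \[ {\bm{m}}_{t+1}=\beta{\bm{m}}_t+\widehat\nabla f_{\mathrm{quad}}({\bm{x}}_t),\qquad {\bm{x}}_{t+1}={\bm{x}}_t-\eta{\bm{m}}_{t+1},\qquad {\bm{m}}_0={\bm{0}}, \] where $\widehat\nabla f_{\mathrm{quad}}({\bm{x}}_t)=\frac{f_{\mathrm{quad}}({\bm{x}}_t+\mu{\bm{u}}_t)-f_{\mathrm{quad}}({\bm{x}}_t-\mu{\bm{u}}_t)}{2\mu}{\bm{u}}_t$ with ${\bm{u}}_t\overset{\mathrm{i.i.d.}}{\sim}\mathcal N({\bm{0}},{\bm{I}}_d)$. Then $\eta^\star_{\mathrm{mean}}=2(1+\beta)/\lambda_{\max}({\bm{H}})$, and the mean-square critical step size $\eta^\star_{\mathrm{ms}}$ is the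 unique $\eta>0$ satisfying \[ \eta\lambda_{\max}({\bm{H}})<1-\beta^2\quad\text{and}\quad\sum_{i=1}^d\frac{\eta\lambda_i}{2(1-\beta)\bigl(1-\frac{\eta\lambda_i}{1-\beta^2}\bigr)}=1, \] and it satisfies \[ \frac{2(1-\beta)}{\Tr({\bm{H}})+\frac{2\lambda_{\max}({\bm{H}})}{1+\beta}}\le\eta^\star_{\mathrm{ms}}\le\frac{2(1-\beta)}{\Tr({\bm{H}})}. \]
   Context: For an optimizer with step size $\eta$ applied to $f_{\mathrm{quad}}$ producing iterates $\{{\bm{x}}_t\}_{t\ge0}$ (with the auxiliary momentum initialized at ${\bm{0}}$), the critical step size in the mean is $\eta^\star_{\mathrm{mean}}:=\sup\{\eta>0:\ \forall {\bm{x}}_0\in\mathbb{R}^d,\ \sup_{t\ge0}\|\mathbb{E}[{\bm{x}}_t-{\bm{x}}^\star]\|<\infty\}$ and the mean-square critical step size is $\eta^\star_{\mathrm{ms}}:=\sup\{\eta>0:\ \forall {\bm{x}}_0\in\mathbb{R}^d,\ \sup_{t\ge0}\mathbb{E}\|{\bm{x}}_t-{\bm{x}}^\star\|^2<\infty\}$. *)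

theory Defs
  imports "HOL-Analysis.Analysis" "HOL-Probability.Probability"
begin

definition local_minimizer :: "('a::metric_space \<Rightarrow> real) \<Rightarrow> 'a \<Rightarrow> bool" where
  "local_minimizer f xs \<longleftrightarrow> (\<exists>e>0. \<forall>y\<in>ball xs e. f xs \<le> f y)"

definition twice_diff_near_with_hessian ::
  "(real^'n \<Rightarrow> real) \<Rightarrow> real^'n \<Rightarrow> real^'n^'n \<Rightarrow> bool" where
  "twice_diff_near_with_hessian f xs H \<longleftrightarrow>
     (\<exists>e>0. \<exists>g. (\<forall>y\<in>ball xs e. (f has_derivative (\<lambda>h. g y \<bullet> h)) (at y) \<and> g differentiable (at y))
            \<and> (g has_derivative (\<lambda>h. H *v h)) (at xs))"

definition psd :: "real^'n^'n \<Rightarrow> bool" where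
  "psd H \<longleftrightarrow> (\<forall>x. 0 \<le> x \<bullet> (H *v x))"

definition eigenvalues_with_mult :: "real^'n^'n \<Rightarrow> ('n \<Rightarrow> real) \<Rightarrow> bool" where
  "eigenvalues_with_mult H lam \<longleftrightarrow>
     (\<exists>Q. orthogonal_matrix Q \<and> (\<forall>i. H *v column i Q = lam i *\<^sub>R column i Q))"

definition f_quad :: "(real^'n \<Rightarrow> real) \<Rightarrow> real^'n \<Rightarrow> real^'n^'n \<Rightarrow> real^'n \<Rightarrow> real" where
  "f_quad f xs H x = f xs + 1/2 * ((x - xs) \<bullet> (H *v (x - xs)))"

fun zo_gdm :: "(real^'n \<Rightarrow> real) \<Rightarrow> real \<Rightarrow> real \<Rightarrow> real \<Rightarrow> real^'n \<Rightarrow> (nat \<Rightarrow> real^'n)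
                \<Rightarrow> nat \<Rightarrow> (real^'n) \<times> (real^'n)" where
  "zo_gdm F eta beta mu x0 u 0 = (x0, 0)"
| "zo_gdm F eta beta mu x0 u (Suc t) =
     (let x = fst (zo_gdm F eta beta mu x0 u t); m = snd (zo_gdm F eta beta mu x0 u t);
          g = ((F (x + mu *\<^sub>R u t) - F (x - mu *\<^sub>R u t)) / (2 * mu)) *\<^sub>R u t;
          m' = beta *\<^sub>R m + g
      in (x - eta *\<^sub>R m', m'))"

text \<open>Probability space carrying i.i.d. N(0, I_d) vectors u_0, u_1, ...:
  all coordinates (t, i) are i.i.d. standard normal.\<close>
definition gauss_space :: "(nat \<times> 'n \<Rightarrow> real) measure" where
  "gauss_space = (\<Pi>\<^sub>M _\<in>UNIV. std_normal_distribution)"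

definition gauss_dirs :: "(nat \<times> 'n \<Rightarrow> real) \<Rightarrow> nat \<Rightarrow> real^'n" where
  "gauss_dirs \<omega> t = (\<chi> i. \<omega> (t, i))"

definition iterate :: "(real^'n \<Rightarrow> real) \<Rightarrow> real \<Rightarrow> real \<Rightarrow> real \<Rightarrow> real^'n
                        \<Rightarrow> nat \<Rightarrow> (nat \<times> 'n \<Rightarrow> real) \<Rightarrow> real^'n" where
  "iterate F eta beta mu x0 t \<omega> = fst (zo_gdm F eta beta mu x0 (gauss_dirs \<omega>) t)"

definition crit_mean :: "(real^'n \<Rightarrow> real) \<Rightarrow> real^'n \<Rightarrow> real \<Rightarrow> real \<Rightarrow> real" where
  "crit_mean F xs beta mu = Sup {eta. eta > 0 \<and> (\<forall>x0. \<exists>B. \<forall>t.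
      norm (\<integral>\<omega>. (iterate F eta beta mu x0 t \<omega> - xs) \<partial>gauss_space) \<le> B)}"

definition crit_ms :: "(real^'n \<Rightarrow> real) \<Rightarrow> real^'n \<Rightarrow> real \<Rightarrow> real \<Rightarrow> real" where
  "crit_ms F xs beta mu = Sup {eta. eta > 0 \<and> (\<forall>x0.
      (SUP t. \<integral>\<^sup>+\<omega>. ennreal ((norm (iterate F eta beta mu x0 t \<omega> - xs))\<^sup>2) \<partial>gauss_space) < \<infinity>)}"

end

theory Submission
  imports Defs
begin

text \<open>
  In an orthonormal eigenbasis of \<open>H\<close> the error components \<open>z\<^sub>i\<close> and their predecessors \<open>y\<^sub>i\<close> have means
  obeying the scalar heavy-ball recursion with \<open>a\<^sub>i = \<eta> \<lambda>\<^sub>i\<close>. By Isserlis' formula the diagonal second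
  moments \<open>X = E z\<^sub>i\<^sup>2\<close>, \<open>Y = E z\<^sub>i y\<^sub>i\<close>, \<open>W = E y\<^sub>i\<^sup>2\<close> form a closed system, coupled only through
  \<open>S = \<Sum>\<^sub>j a\<^sub>j\<^sup>2 E z\<^sub>j\<^sup>2\<close>. With \<open>\<theta>\<^sub>i = 1 - a\<^sub>i / (1 + \<beta>)\<close> the quadratic form
  \<open>V\<^sub>i = X - 2 \<theta>\<^sub>i \<beta> Y + \<beta>\<^sup>2 W\<close> changes in one step by exactly
  \<open>- 2 (1 - \<beta>) a\<^sub>i (1 - a\<^sub>i / (1 - \<beta>\<^sup>2)) X + S\<close>.
  Weighting \<open>V\<^sub>i\<close> by the \<open>i\<close>-th summand \<open>w\<^sub>i\<close> of the threshold equation makes the \<open>X\<close>-terms add up to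
  \<open>- S\<close>, so that \<open>\<Sum>\<^sub>i w\<^sub>i V\<^sub>i\<close> changes by \<open>(\<Sum>\<^sub>i w\<^sub>i - 1) S\<close>: a Lyapunov function below the threshold and
  a certificate of instability above it.
\<close>

section \<open>Gaussian directions\<close>

lemma sets_gauss_space [measurable_cong]:
  "sets gauss_space = sets (\<Pi>\<^sub>M _\<in>(UNIV :: (nat \<times> 'n) set). (borel :: real measure))"
  unfolding gauss_space_def by (intro sets_PiM_cong) auto

lemma space_gauss_space [simp]: "space gauss_space = UNIV"
  unfolding gauss_space_def by (simp add: space_PiM)

lemma prob_space_std_normal: "prob_space std_normal_distribution"
  by (rule prob_space_normal_density) simp

lemma prob_space_gauss_space: "prob_space gauss_space"
  unfolding gauss_space_def by (intro prob_space_PiM prob_space_std_normal)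

interpretation gauss: prob_space "gauss_space :: (nat \<times> 'n \<Rightarrow> real) measure"
  by (rule prob_space_gauss_space)

lemma gauss_component_measurable [measurable]:
  "(\<lambda>\<omega>. \<omega> p) \<in> borel_measurable gauss_space"
proof -
  have "(\<lambda>\<omega>. \<omega> p) \<in> measurable (\<Pi>\<^sub>M _\<in>UNIV. (borel :: real measure)) borel"
    by (rule measurable_component_singleton) simp
  then show ?thesis by (simp cong: measurable_cong_sets add: sets_gauss_space)
qed

lemma distr_gauss_component: "distr gauss_space borel (\<lambda>\<omega>. \<omega> p) = std_normal_distribution"
proof -
  have "distr gauss_space std_normal_distribution (\<lambda>\<omega>. \<omega> p) = std_normal_distribution"
    unfolding gauss_space_def by (rule distr_PiM_component) (auto intro: prob_space_std_normal)
  moreover have "distr gauss_space std_normal_distribution (\<lambda>\<omega>. \<omega> p) = distr gauss_space borel (\<lambda>\<omega>. \<omega> p)"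
    by (rule distr_cong) auto
  ultimately show ?thesis by simp
qed

lemma gauss_component_distributed:
  "distributed gauss_space lborel (\<lambda>\<omega>. \<omega> p) std_normal_density"
proof -
  have "distr gauss_space lborel (\<lambda>\<omega>. \<omega> p) = distr gauss_space borel (\<lambda>\<omega>. \<omega> p)"
    by (rule distr_cong) auto
  then show ?thesis
    unfolding distributed_def by (simp add: distr_gauss_component)
qed

text \<open>The joint law of all coordinates is \<open>gauss_space\<close> itself, which is by
  construction the product of their marginals; this equality characterizes independence.\<close>

lemma gauss_indep_components: "gauss.indep_vars (\<lambda>_. borel) (\<lambda>p \<omega>. \<omega> p) UNIV"
proof (subst gauss.indep_vars_iff_distr_eq_PiM)
  have "distr gauss_space (\<Pi>\<^sub>M _\<in>UNIV. borel) (\<lambda>\<omega>. \<lambda>p\<in>UNIV. \<omega> p)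
      = distr gauss_space gauss_space (\<lambda>\<omega>. \<omega>)"
    by (rule distr_cong) (auto simp: sets_gauss_space restrict_def)
  also have "\<dots> = gauss_space" by simp
  also have "\<dots> = (\<Pi>\<^sub>M p\<in>UNIV. distr gauss_space borel (\<lambda>\<omega>. \<omega> p))"
    unfolding distr_gauss_component by (simp add: gauss_space_def)
  finally show "distr gauss_space (\<Pi>\<^sub>M _\<in>UNIV. borel) (\<lambda>\<omega>. \<lambda>p\<in>UNIV. \<omega> p)
      = (\<Pi>\<^sub>M p\<in>UNIV. distr gauss_space borel (\<lambda>\<omega>. \<omega> p))" .
qed auto

text \<open>Each function factors through the restriction to its own coordinate set, and
  restrictions of an independent family to disjoint index sets are independent.\<close>

lemma gauss_indep_var:
  fixes A B :: "(nat \<times> 'n \<Rightarrow> real) \<Rightarrow> real"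
  assumes [measurable]: "A \<in> borel_measurable gauss_space" "B \<in> borel_measurable gauss_space"
    and A: "\<And>\<omega> \<omega>'. (\<And>p. p \<in> I \<Longrightarrow> \<omega> p = \<omega>' p) \<Longrightarrow> A \<omega> = A \<omega>'"
    and B: "\<And>\<omega> \<omega>'. (\<And>p. p \<in> J \<Longrightarrow> \<omega> p = \<omega>' p) \<Longrightarrow> B \<omega> = B \<omega>'"
    and IJ: "I \<inter> J = {}"
  shows "gauss.indep_var borel A borel B"
proof -
  \<comment> \<open>Extension by zero turns a partial coordinate assignment into a full one, so that
    \<open>A\<close> and \<open>B\<close> can be read as functions of the restrictions; the filler
    value is invisible to them.\<close>
  define ext :: "(nat \<times> 'n) set \<Rightarrow> (nat \<times> 'n \<Rightarrow> real) \<Rightarrow> nat \<times> 'n \<Rightarrow> real"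
    where "ext = (\<lambda>K x p. if p \<in> K then x p else 0)"
  have ext: "ext K \<in> measurable (\<Pi>\<^sub>M _\<in>K. borel) gauss_space" for K
  proof -
    have "ext K \<in> measurable (\<Pi>\<^sub>M _\<in>K. borel) (\<Pi>\<^sub>M _\<in>UNIV. borel)"
    proof (rule measurable_PiM_single')
      show "(\<lambda>x. ext K x p) \<in> borel_measurable (\<Pi>\<^sub>M _\<in>K. borel)" for p
        by (cases "p \<in> K") (auto simp: ext_def intro: measurable_component_singleton)
    qed auto
    then show ?thesis by (simp cong: measurable_cong_sets add: sets_gauss_space)
  qed
  have "gauss.indep_var borel ((A \<circ> ext I) \<circ> (\<lambda>\<omega>. restrict \<omega> I)) borel ((B \<circ> ext J) \<circ> (\<lambda>\<omega>. restrict \<omega> J))"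
    by (intro gauss.indep_var_compose[OF gauss.indep_var_restrict[OF gauss_indep_components IJ]]
        measurable_comp[OF ext] assms(1,2)) auto
  also have "(A \<circ> ext I) \<circ> (\<lambda>\<omega>. restrict \<omega> I) = A"
    by (rule HOL.ext, unfold o_def, rule A) (simp add: ext_def)
  also have "(B \<circ> ext J) \<circ> (\<lambda>\<omega>. restrict \<omega> J) = B"
    by (rule HOL.ext, unfold o_def, rule B) (simp add: ext_def)
  finally show ?thesis .
qed

section \<open>Moments of linear forms in one Gaussian direction\<close>

lemma inner_gauss_dirs: "b \<bullet> gauss_dirs \<omega> t = (\<Sum>k\<in>UNIV. b $ k * \<omega> (t, k))"
  by (simp add: inner_vec_def gauss_dirs_def)

lemma inner_gauss_dirs_measurable [measurable]:
  "(\<lambda>\<omega>. b \<bullet> gauss_dirs \<omega> t) \<in> borel_measurable gauss_space"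
  unfolding inner_gauss_dirs by measurable

lemma inner_gauss_dirs_distributed:
  fixes b :: "real^'n"
  assumes "b \<noteq> 0"
  shows "distributed gauss_space lborel (\<lambda>\<omega>. b \<bullet> gauss_dirs \<omega> t) (normal_density 0 (norm b))"
proof -
  \<comment> \<open>Only coordinates with a nonzero coefficient are summed, because every summand
    must have a normal density with positive standard deviation. As \<open>b\<close> is nonzero,
    some coordinate remains.\<close>
  define S where "S = Pair t ` {k. b $ k \<noteq> 0}"
  have "finite S" "S \<noteq> {}" using assms by (auto simp: S_def vec_eq_iff)
  have ind: "gauss.indep_vars (\<lambda>_. borel) (\<lambda>p \<omega>. b $ snd p * \<omega> p) S"
    by (rule gauss.indep_vars_compose2[where Y="\<lambda>p x. b $ snd p * x",
          OF gauss.indep_vars_subset[OF gauss_indep_components]]) auto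
  have "distributed gauss_space lborel (\<lambda>\<omega>. \<Sum>p\<in>S. b $ snd p * \<omega> p)
      (normal_density (\<Sum>p\<in>S. 0) (sqrt (\<Sum>p\<in>S. \<bar>b $ snd p\<bar>\<^sup>2)))"
  proof (rule gauss.sum_indep_normal)
    fix p assume "p \<in> S"
    then show "distributed gauss_space lborel (\<lambda>\<omega>. b $ snd p * \<omega> p) (normal_density 0 \<bar>b $ snd p\<bar>)"
      using gauss.normal_density_affine[OF gauss_component_distributed, of "b $ snd p" 0 p]
      by (auto simp: S_def)
  qed (use \<open>finite S\<close> \<open>S \<noteq> {}\<close> ind in \<open>auto simp: S_def\<close>)
  moreover have "(\<Sum>p\<in>S. b $ snd p * \<omega> p) = b \<bullet> gauss_dirs \<omega> t" for \<omega>
    unfolding inner_gauss_dirs S_def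
    by (subst sum.reindex) (auto simp: inj_on_def intro: sum.mono_neutral_left)
  moreover have "sqrt (\<Sum>p\<in>S. \<bar>b $ snd p\<bar>\<^sup>2) = norm b"
  proof -
    have "(\<Sum>p\<in>S. \<bar>b $ snd p\<bar>\<^sup>2) = (\<Sum>k\<in>UNIV. \<bar>b $ k\<bar>\<^sup>2)"
      unfolding S_def by (subst sum.reindex) (auto simp: inj_on_def intro: sum.mono_neutral_left)
    then show ?thesis by (simp add: norm_vec_def L2_set_def)
  qed
  ultimately show ?thesis by simp
qed

text \<open>The even moments of a centred normal variable of standard deviation
  \<open>norm b\<close>. The case \<open>b = 0\<close> is separate because the law is then
  degenerate and has no density.\<close>

lemma inner_gauss_dirs_even_moment:
  fixes b :: "real^'n"
  shows "has_bochner_integral gauss_space (\<lambda>\<omega>. (b \<bullet> gauss_dirs \<omega> t) ^ (2 * k))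
    (fact (2 * k) / (2 ^ k * fact k) * norm b ^ (2 * k))"
proof (cases "b = 0")
  case True
  then show ?thesis
    using gauss.prob_space by (cases k) (auto simp: power_0_left has_bochner_integral_iff)
next
  case False
  then have pos: "0 < norm b" by simp
  note D = inner_gauss_dirs_distributed[OF False, of t]
  note M = normal_moment_even[OF pos, of 0 k]
  have "integrable gauss_space (\<lambda>\<omega>. (b \<bullet> gauss_dirs \<omega> t) ^ (2 * k))"
    using M by (subst distributed_integrable[OF D, symmetric]) (auto simp: has_bochner_integral_iff)
  moreover have "(\<integral>\<omega>. (b \<bullet> gauss_dirs \<omega> t) ^ (2 * k) \<partial>gauss_space) =
      fact (2 * k) / ((2 / (norm b)\<^sup>2)^k * fact k)"
    using M by (subst distributed_integral[OF D, symmetric]) (auto simp: has_bochner_integral_iff)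
  moreover have "fact (2 * k) / ((2 / (norm b)\<^sup>2)^k * fact k) = fact (2 * k) / (2 ^ k * fact k) * norm b ^ (2 * k)"
    using pos by (simp add: power_divide power_mult)
  ultimately show ?thesis by (simp add: has_bochner_integral_iff)
qed

text \<open>Polarization: a product of two linear forms is a quarter of the difference of the
  squares of their sum and difference.\<close>

lemma gauss_second_moment:
  fixes a b :: "real^'n"
  shows "has_bochner_integral gauss_space (\<lambda>\<omega>. (a \<bullet> gauss_dirs \<omega> t) * (b \<bullet> gauss_dirs \<omega> t)) (a \<bullet> b)"
proof -
  have sq: "has_bochner_integral gauss_space (\<lambda>\<omega>. (c \<bullet> gauss_dirs \<omega> t)\<^sup>2) (c \<bullet> c)" for c :: "real^'n"
    using inner_gauss_dirs_even_moment[of c t 1] by (simp add: power2_norm_eq_inner)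
  have "has_bochner_integral gauss_space
      (\<lambda>\<omega>. (((a + b) \<bullet> gauss_dirs \<omega> t)\<^sup>2 - ((a - b) \<bullet> gauss_dirs \<omega> t)\<^sup>2) * (1/4))
      (((a + b) \<bullet> (a + b) - (a - b) \<bullet> (a - b)) * (1/4))"
    by (intro has_bochner_integral_mult_left has_bochner_integral_diff sq)
  moreover have "((a + b) \<bullet> (a + b) - (a - b) \<bullet> (a - b)) * (1/4) = a \<bullet> b"
    by (simp add: algebra_simps inner_commute)
  moreover have "(((a + b) \<bullet> gauss_dirs \<omega> t)\<^sup>2 - ((a - b) \<bullet> gauss_dirs \<omega> t)\<^sup>2) * (1/4)
      = (a \<bullet> gauss_dirs \<omega> t) * (b \<bullet> gauss_dirs \<omega> t)" for \<omega>
    by (simp add: inner_add_left inner_diff_left power2_eq_square algebra_simps)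
  ultimately show ?thesis by simp
qed

text \<open>Obtained by polarizing the fourth moments of linear forms.\<close>

lemma gauss_fourth_moment:
  fixes a b c :: "real^'n"
  shows "has_bochner_integral gauss_space
      (\<lambda>\<omega>. (a \<bullet> gauss_dirs \<omega> t)\<^sup>2 * ((b \<bullet> gauss_dirs \<omega> t) * (c \<bullet> gauss_dirs \<omega> t)))
      ((a \<bullet> a) * (b \<bullet> c) + 2 * (a \<bullet> b) * (a \<bullet> c))"
proof -
  let ?u = "\<lambda>\<omega>. gauss_dirs \<omega> t :: real^'n"
  have quart: "has_bochner_integral gauss_space (\<lambda>\<omega>. (c \<bullet> ?u \<omega>)^4) (3 * (c \<bullet> c)\<^sup>2)" for c :: "real^'n"
  proof -
    have "fact 4 / (8::real) = 3" by (simp add: fact_numeral)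
    then show ?thesis
    using inner_gauss_dirs_even_moment[of c t 2] 
    by (simp add: power2_norm_eq_inner[symmetric])
  qed
  \<comment> \<open>First polarization:
    \<open>(s + r)^4 + (s - r)^4 - 2 * s^4 - 2 * r^4 = 12 * s^2 * r^2\<close>.\<close>
  have sq: "has_bochner_integral gauss_space (\<lambda>\<omega>. (a \<bullet> ?u \<omega>)\<^sup>2 * (d \<bullet> ?u \<omega>)\<^sup>2)
      ((a \<bullet> a) * (d \<bullet> d) + 2 * (a \<bullet> d)\<^sup>2)" for d
  proof -
    have "has_bochner_integral gauss_space
      (\<lambda>\<omega>. (((a + d) \<bullet> ?u \<omega>)^4 + ((a - d) \<bullet> ?u \<omega>)^4 - 2 * (a \<bullet> ?u \<omega>)^4 - 2 * (d \<bullet> ?u \<omega>)^4) * (1/12))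
      ((3 * ((a + d) \<bullet> (a + d))\<^sup>2 + 3 * ((a - d) \<bullet> (a - d))\<^sup>2 - 2 * (3 * (a \<bullet> a)\<^sup>2) - 2 * (3 * (d \<bullet> d)\<^sup>2)) * (1/12))"
      by (intro has_bochner_integral_mult_left has_bochner_integral_mult_right has_bochner_integral_diff
          has_bochner_integral_add quart)
    moreover have "(3 * ((a + d) \<bullet> (a + d))\<^sup>2 + 3 * ((a - d) \<bullet> (a - d))\<^sup>2 - 2 * (3 * (a \<bullet> a)\<^sup>2) - 2 * (3 * (d \<bullet> d)\<^sup>2)) * (1/12)
      = (a \<bullet> a) * (d \<bullet> d) + 2 * (a \<bullet> d)\<^sup>2"
      by (simp add: inner_add_left inner_diff_left inner_add_right inner_diff_right inner_commute[of d a]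
          power2_eq_square algebra_simps)
    moreover have "(((a + d) \<bullet> ?u \<omega>)^4 + ((a - d) \<bullet> ?u \<omega>)^4 - 2 * (a \<bullet> ?u \<omega>)^4 - 2 * (d \<bullet> ?u \<omega>)^4) * (1/12)
       = (a \<bullet> ?u \<omega>)\<^sup>2 * (d \<bullet> ?u \<omega>)\<^sup>2" for \<omega>
      by (simp add: inner_add_left inner_diff_left power2_eq_square power4_eq_xxxx algebra_simps)
    ultimately show ?thesis by (simp only:)
  qed
  \<comment> \<open>Second polarization, splitting the squared factor into the two forms given by
    \<open>b\<close> and \<open>c\<close>.\<close>
  have "has_bochner_integral gauss_space
      (\<lambda>\<omega>. ((a \<bullet> ?u \<omega>)\<^sup>2 * ((b + c) \<bullet> ?u \<omega>)\<^sup>2 - (a \<bullet> ?u \<omega>)\<^sup>2 * ((b - c) \<bullet> ?u \<omega>)\<^sup>2) * (1/4))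
      ((((a \<bullet> a) * ((b + c) \<bullet> (b + c)) + 2 * (a \<bullet> (b + c))\<^sup>2)
        - ((a \<bullet> a) * ((b - c) \<bullet> (b - c)) + 2 * (a \<bullet> (b - c))\<^sup>2)) * (1/4))"
    by (intro has_bochner_integral_mult_left has_bochner_integral_diff sq)
  moreover have "(((a \<bullet> a) * ((b + c) \<bullet> (b + c)) + 2 * (a \<bullet> (b + c))\<^sup>2)
        - ((a \<bullet> a) * ((b - c) \<bullet> (b - c)) + 2 * (a \<bullet> (b - c))\<^sup>2)) * (1/4)
       = (a \<bullet> a) * (b \<bullet> c) + 2 * (a \<bullet> b) * (a \<bullet> c)"
    by (simp add: inner_add_left inner_diff_left inner_add_right inner_diff_right inner_commute[of c b]
          power2_eq_square algebra_simps)
  moreover have "((a \<bullet> ?u \<omega>)\<^sup>2 * ((b + c) \<bullet> ?u \<omega>)\<^sup>2 - (a \<bullet> ?u \<omega>)\<^sup>2 * ((b - c) \<bullet> ?u \<omega>)\<^sup>2) * (1/4)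
      = (a \<bullet> ?u \<omega>)\<^sup>2 * ((b \<bullet> ?u \<omega>) * (c \<bullet> ?u \<omega>))" for \<omega>
    by (simp add: inner_add_left inner_diff_left power2_eq_square algebra_simps)
  ultimately show ?thesis by (simp only:)
qed

section \<open>Moment recursions in an eigenbasis\<close>

definition adapted :: "nat \<Rightarrow> ((nat \<times> 'n \<Rightarrow> real) \<Rightarrow> real) \<Rightarrow> bool" where
  "adapted t A \<longleftrightarrow> A \<in> borel_measurable gauss_space \<and>
     (\<forall>\<omega> \<omega>'. (\<forall>s<t. \<forall>k. \<omega> (s, k) = \<omega>' (s, k)) \<longrightarrow> A \<omega> = A \<omega>')"

lemma adapted_measurable: "adapted t A \<Longrightarrow> A \<in> borel_measurable gauss_space"
  by (simp add: adapted_def)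

lemma adapted_mult:
  assumes "adapted t A" "adapted t B"
  shows "adapted t (\<lambda>\<omega>. A \<omega> * B \<omega>)"
  using assms unfolding adapted_def by (auto intro!: arg_cong2[of _ _ _ _ "(*)"])

text \<open>The expectation factorizes because \<open>A\<close> only sees coordinates of times
  before \<open>t\<close>, while the direction at time \<open>t\<close> only sees those of time
  \<open>t\<close>. Phrasing \<open>adapted\<close> through coordinates instead of a filtration
  gives exactly the premises of \<open>gauss_indep_var\<close>.\<close>

lemma adapted_mult_fresh:
  fixes A :: "(nat \<times> 'n::finite \<Rightarrow> real) \<Rightarrow> real"
  assumes A: "adapted t A" "integrable gauss_space A"
    and h: "has_bochner_integral gauss_space (\<lambda>\<omega>. h (gauss_dirs \<omega> t)) b"
  shows "has_bochner_integral gauss_space (\<lambda>\<omega>. A \<omega> * h (gauss_dirs \<omega> t)) ((\<integral>\<omega>. A \<omega> \<partial>gauss_space) * b)"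
proof -
  have ind: "gauss.indep_var borel A borel (\<lambda>\<omega>. h (gauss_dirs \<omega> t))"
  proof (rule gauss_indep_var)
    show "A \<omega> = A \<omega>'" if "\<And>p. p \<in> {..<t} \<times> UNIV \<Longrightarrow> \<omega> p = \<omega>' p" for \<omega> \<omega>'
      using A(1) that by (auto simp: adapted_def)
    show "h (gauss_dirs \<omega> t) = h (gauss_dirs \<omega>' t)" if "\<And>p. p \<in> {t} \<times> UNIV \<Longrightarrow> \<omega> p = \<omega>' p" for \<omega> \<omega>'
      using that by (simp add: gauss_dirs_def)
  qed (use A h in \<open>auto simp: has_bochner_integral_iff\<close>)
  have h': "integrable gauss_space (\<lambda>\<omega>. h (gauss_dirs \<omega> t))" "(\<integral>\<omega>. h (gauss_dirs \<omega> t) \<partial>gauss_space) = b"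
    using h by (auto simp: has_bochner_integral_iff)
  show ?thesis
    using gauss.indep_var_integrable[OF ind A(2) h'(1)] gauss.indep_var_lebesgue_integral[OF ind A(2) h'(1)]
    by (simp add: has_bochner_integral_iff h')
qed

lemma integrable_mult_of_squares:
  fixes f g :: "'a \<Rightarrow> real"
  assumes [measurable]: "f \<in> borel_measurable M" "g \<in> borel_measurable M"
    and "integrable M (\<lambda>x. (f x)\<^sup>2)" "integrable M (\<lambda>x. (g x)\<^sup>2)"
  shows "integrable M (\<lambda>x. f x * g x)"
proof (rule Bochner_Integration.integrable_bound)
  show "integrable M (\<lambda>x. (f x)\<^sup>2 + (g x)\<^sup>2)" using assms by simp
  have "\<bar>a * b\<bar> \<le> \<bar>a\<^sup>2 + b\<^sup>2\<bar>" for a b :: real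
  proof -
    have "2 * \<bar>a\<bar> * \<bar>b\<bar> \<le> a\<^sup>2 + b\<^sup>2" using sum_squares_bound[of "\<bar>a\<bar>" "\<bar>b\<bar>"] by simp
    moreover have "0 \<le> \<bar>a\<bar> * \<bar>b\<bar>" by simp
    ultimately show ?thesis
      unfolding abs_mult using abs_ge_self[of "a\<^sup>2 + b\<^sup>2"] by linarith
  qed
  then show "AE x in M. norm (f x * g x) \<le> norm ((f x)\<^sup>2 + (g x)\<^sup>2)"
    by simp
qed simp

text \<open>The momentum \<open>m\<close> is encoded by the previous error \<open>y t = z t + eta * m t\<close>, so \<open>y 0 = z 0\<close>.\<close>

locale eigen_process =
  fixes q :: "'n::finite \<Rightarrow> real^'n" and lam :: "'n \<Rightarrow> real" and eta beta :: real and x :: "'n \<Rightarrow> real"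
    and z y :: "nat \<Rightarrow> 'n \<Rightarrow> (nat \<times> 'n \<Rightarrow> real) \<Rightarrow> real"
  assumes orthonormal: "q i \<bullet> q j = (if i = j then 1 else 0)"
    and z_0: "z 0 i \<omega> = x i" and y_0: "y 0 i \<omega> = x i"
    and z_Suc: "z (Suc t) i \<omega> = (1 + beta) * z t i \<omega> - beta * y t i \<omega>
      - eta * ((q i \<bullet> gauss_dirs \<omega> t) * (\<Sum>j\<in>UNIV. lam j * z t j \<omega> * (q j \<bullet> gauss_dirs \<omega> t)))"
    and y_Suc: "y (Suc t) i \<omega> = z t i \<omega>"
begin

abbreviation (input) "drift t i \<omega> \<equiv> (1 + beta) * z t i \<omega> - beta * y t i \<omega>"
abbreviation (input) "grad t i \<omega> \<equiv> (q i \<bullet> gauss_dirs \<omega> t) * (\<Sum>j\<in>UNIV. lam j * z t j \<omega> * (q j \<bullet> gauss_dirs \<omega> t))"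

lemma adapted_z_y: "adapted t (z t i) \<and> adapted t (y t i)"
proof (induction t arbitrary: i)
  case 0
  have "z 0 i = (\<lambda>_. x i)" "y 0 i = (\<lambda>_. x i)" by (auto simp: z_0 y_0)
  then show ?case by (simp add: adapted_def)
next
  case (Suc t)
  note [measurable] = adapted_measurable[OF Suc.IH[THEN conjunct1]] adapted_measurable[OF Suc.IH[THEN conjunct2]]
  have yS: "y (Suc t) i = z t i" by (auto simp: y_Suc)
  have zS: "z (Suc t) i = (\<lambda>\<omega>. drift t i \<omega> - eta * grad t i \<omega>)" by (auto simp: z_Suc)
  have "z (Suc t) i \<in> borel_measurable gauss_space"
    unfolding zS by measurable
  moreover have "z (Suc t) i \<omega> = z (Suc t) i \<omega>'"
    if "\<forall>s<Suc t. \<forall>k. \<omega> (s, k) = \<omega>' (s, k)" for \<omega> \<omega>'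
  proof -
    have "z t j \<omega> = z t j \<omega>'" "y t j \<omega> = y t j \<omega>'" for j
      using Suc.IH[of j] that by (auto simp: adapted_def)
    moreover have "gauss_dirs \<omega> t = gauss_dirs \<omega>' t"
      using that by (simp add: gauss_dirs_def)
    ultimately show ?thesis by (simp add: z_Suc)
  qed
  ultimately show ?case
    using Suc.IH[of i] unfolding yS by (auto simp: adapted_def)
qed

lemmas adapted_z = adapted_z_y[THEN conjunct1] and adapted_y = adapted_z_y[THEN conjunct2]

lemma z_measurable [measurable]: "z t i \<in> borel_measurable gauss_space"
  and y_measurable [measurable]: "y t i \<in> borel_measurable gauss_space"
  using adapted_measurable[OF adapted_z] adapted_measurable[OF adapted_y] by simp_all

lemma adapted_drift: "adapted t (drift t i)"
  using adapted_z[of t i] adapted_y[of t i] unfolding adapted_def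
  by (auto intro!: arg_cong2[of _ _ _ _ "(-)"] arg_cong2[of _ _ _ _ "(*)"])

text \<open>Expand the square of drift minus \<open>eta\<close> times gradient and average over the
  fresh direction, which is independent of the past. Square integrability at time \<open>t\<close>
  is a premise, so that the lemma can also drive the induction in
  \<open>square_integrable\<close>.\<close>

lemma z_Suc_square:
  assumes sq: "\<And>i. integrable gauss_space (\<lambda>\<omega>. (z t i \<omega>)\<^sup>2)" "\<And>i. integrable gauss_space (\<lambda>\<omega>. (y t i \<omega>)\<^sup>2)"
  shows "has_bochner_integral gauss_space (\<lambda>\<omega>. (z (Suc t) i \<omega>)\<^sup>2)
      ((\<integral>\<omega>. (drift t i \<omega>)\<^sup>2 \<partial>gauss_space)
        - 2 * eta * (lam i * (\<integral>\<omega>. drift t i \<omega> * z t i \<omega> \<partial>gauss_space))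
        + eta\<^sup>2 * ((\<Sum>j\<in>UNIV. (lam j)\<^sup>2 * (\<integral>\<omega>. (z t j \<omega>)\<^sup>2 \<partial>gauss_space))
                 + 2 * (lam i)\<^sup>2 * (\<integral>\<omega>. (z t i \<omega>)\<^sup>2 \<partial>gauss_space)))" (is ?goal1)
    and "has_bochner_integral gauss_space (\<lambda>\<omega>. z (Suc t) i \<omega> * z t i \<omega>)
      ((\<integral>\<omega>. drift t i \<omega> * z t i \<omega> \<partial>gauss_space) - eta * (lam i * (\<integral>\<omega>. (z t i \<omega>)\<^sup>2 \<partial>gauss_space)))" (is ?goal2)
proof -
  let ?v = "\<lambda>j \<omega>. q j \<bullet> gauss_dirs \<omega> t"
  let ?E = "\<lambda>A. \<integral>\<omega>. A \<omega> \<partial>gauss_space"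
  have zz: "integrable gauss_space (\<lambda>\<omega>. z t j \<omega> * z t k \<omega>)" for j k
    by (rule integrable_mult_of_squares) (use sq in auto)
  have yz: "integrable gauss_space (\<lambda>\<omega>. y t j \<omega> * z t k \<omega>)" for j k
    by (rule integrable_mult_of_squares) (use sq in auto)
  have dz: "integrable gauss_space (\<lambda>\<omega>. drift t i \<omega> * z t j \<omega>)" for j
  proof -
    have "integrable gauss_space (\<lambda>\<omega>. (1 + beta) * (z t i \<omega> * z t j \<omega>) - beta * (y t i \<omega> * z t j \<omega>))"
      by (intro Bochner_Integration.integrable_diff integrable_mult_right zz yz)
    then show ?thesis by (simp add: algebra_simps)
  qed
  have d2: "integrable gauss_space (\<lambda>\<omega>. (drift t i \<omega>)\<^sup>2)"
  proof -
    have "integrable gauss_space (\<lambda>\<omega>. (1 + beta)\<^sup>2 * (z t i \<omega>)\<^sup>2 - 2 * (1 + beta) * beta * (y t i \<omega> * z t i \<omega>)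
        + beta\<^sup>2 * (y t i \<omega>)\<^sup>2)"
      by (intro Bochner_Integration.integrable_diff Bochner_Integration.integrable_add
          integrable_mult_right sq yz)
    then show ?thesis by (simp add: algebra_simps power2_eq_square)
  qed
  \<comment> \<open>Seen from the past, the gradient component averages to
    \<open>lam i * z t i\<close>. This is used twice, with the drift and with \<open>z t i\<close>
    in the role of \<open>A\<close>.\<close>
  have cross: "has_bochner_integral gauss_space (\<lambda>\<omega>. A \<omega> * grad t i \<omega>) (lam i * ?E (\<lambda>\<omega>. A \<omega> * z t i \<omega>))"
    if A: "adapted t A" "\<And>j. integrable gauss_space (\<lambda>\<omega>. A \<omega> * z t j \<omega>)" for A
  proof -
    have "has_bochner_integral gauss_space
        (\<lambda>\<omega>. \<Sum>j\<in>UNIV. lam j * ((A \<omega> * z t j \<omega>) * (?v i \<omega> * ?v j \<omega>)))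
        (\<Sum>j\<in>UNIV. lam j * (?E (\<lambda>\<omega>. A \<omega> * z t j \<omega>) * (q i \<bullet> q j)))"
      by (intro has_bochner_integral_sum has_bochner_integral_mult_right
          adapted_mult_fresh[where h="\<lambda>u. (q i \<bullet> u) * (q _ \<bullet> u)"] adapted_mult A adapted_z gauss_second_moment)
    moreover have "(\<Sum>j\<in>UNIV. lam j * ((A \<omega> * z t j \<omega>) * (?v i \<omega> * ?v j \<omega>))) = A \<omega> * grad t i \<omega>" for \<omega>
      by (simp add: sum_distrib_left algebra_simps)
    moreover have "(\<Sum>j\<in>UNIV. lam j * (?E (\<lambda>\<omega>. A \<omega> * z t j \<omega>) * (q i \<bullet> q j))) = lam i * ?E (\<lambda>\<omega>. A \<omega> * z t i \<omega>)"
      by (simp add: orthonormal if_distrib cong: if_cong)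
    ultimately show ?thesis by (simp only:)
  qed
  \<comment> \<open>Isserlis' formula: by orthonormality only the terms with \<open>j = k\<close>
    survive, and the term with \<open>j = k = i\<close> receives the additional factor two.\<close>
  have grad2: "has_bochner_integral gauss_space (\<lambda>\<omega>. (grad t i \<omega>)\<^sup>2)
      ((\<Sum>j\<in>UNIV. (lam j)\<^sup>2 * ?E (\<lambda>\<omega>. (z t j \<omega>)\<^sup>2)) + 2 * (lam i)\<^sup>2 * ?E (\<lambda>\<omega>. (z t i \<omega>)\<^sup>2))"
  proof -
    have "has_bochner_integral gauss_space
        (\<lambda>\<omega>. \<Sum>j\<in>UNIV. \<Sum>k\<in>UNIV. (lam j * lam k) * ((z t j \<omega> * z t k \<omega>) * ((?v i \<omega>)\<^sup>2 * (?v j \<omega> * ?v k \<omega>))))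
        (\<Sum>j\<in>UNIV. \<Sum>k\<in>UNIV. (lam j * lam k) * (?E (\<lambda>\<omega>. z t j \<omega> * z t k \<omega>) *
           ((q i \<bullet> q i) * (q j \<bullet> q k) + 2 * (q i \<bullet> q j) * (q i \<bullet> q k))))"
      by (intro has_bochner_integral_sum has_bochner_integral_mult_right zz
          adapted_mult_fresh[where h="\<lambda>u. (q i \<bullet> u)\<^sup>2 * ((q _ \<bullet> u) * (q _ \<bullet> u))"] adapted_mult adapted_z
          gauss_fourth_moment)
    moreover have "(\<Sum>j\<in>UNIV. \<Sum>k\<in>UNIV. (lam j * lam k) * ((z t j \<omega> * z t k \<omega>) * ((?v i \<omega>)\<^sup>2 * (?v j \<omega> * ?v k \<omega>))))
       = (grad t i \<omega>)\<^sup>2" for \<omega>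
    proof -
      let ?f = "\<lambda>j. lam j * z t j \<omega> * ?v j \<omega>"
      have "(grad t i \<omega>)\<^sup>2 = (?v i \<omega>)\<^sup>2 * (sum ?f UNIV * sum ?f UNIV)"
        by (simp add: power_mult_distrib power2_eq_square)
      also have "\<dots> = (\<Sum>j\<in>UNIV. \<Sum>k\<in>UNIV. (?v i \<omega>)\<^sup>2 * (?f j * ?f k))"
        by (subst sum_product) (simp only: sum_distrib_left)
      also have "\<dots> = (\<Sum>j\<in>UNIV. \<Sum>k\<in>UNIV. (lam j * lam k) * ((z t j \<omega> * z t k \<omega>) * ((?v i \<omega>)\<^sup>2 * (?v j \<omega> * ?v k \<omega>))))"
        by (intro sum.cong refl) (simp only: mult_ac)
      finally show ?thesis by (rule sym)
    qed
    moreover have "(\<Sum>j\<in>UNIV. \<Sum>k\<in>UNIV. (lam j * lam k) * (?E (\<lambda>\<omega>. z t j \<omega> * z t k \<omega>) *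
           ((q i \<bullet> q i) * (q j \<bullet> q k) + 2 * (q i \<bullet> q j) * (q i \<bullet> q k))))
       = (\<Sum>j\<in>UNIV. (lam j)\<^sup>2 * ?E (\<lambda>\<omega>. (z t j \<omega>)\<^sup>2)) + 2 * (lam i)\<^sup>2 * ?E (\<lambda>\<omega>. (z t i \<omega>)\<^sup>2)"
    proof -
      \<comment> \<open>The coefficient is split into two Kronecker deltas so that each double sum
        collapses on its own.\<close>
      have "(lam j * lam k) * (?E (\<lambda>\<omega>. z t j \<omega> * z t k \<omega>) *
           ((q i \<bullet> q i) * (q j \<bullet> q k) + 2 * (q i \<bullet> q j) * (q i \<bullet> q k)))
        = (if k = j then (lam j)\<^sup>2 * ?E (\<lambda>\<omega>. (z t j \<omega>)\<^sup>2) else 0)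
          + (if k = j then if j = i then 2 * (lam i)\<^sup>2 * ?E (\<lambda>\<omega>. (z t i \<omega>)\<^sup>2) else 0 else 0)" for j k
        by (simp add: orthonormal power2_eq_square)
      then show ?thesis by (simp add: sum.distrib)
    qed
    ultimately show ?thesis by (simp only:)
  qed
  have "has_bochner_integral gauss_space
      (\<lambda>\<omega>. (drift t i \<omega>)\<^sup>2 - 2 * eta * (drift t i \<omega> * grad t i \<omega>) + eta\<^sup>2 * (grad t i \<omega>)\<^sup>2)
      (?E (\<lambda>\<omega>. (drift t i \<omega>)\<^sup>2) - 2 * eta * (lam i * ?E (\<lambda>\<omega>. drift t i \<omega> * z t i \<omega>))
        + eta\<^sup>2 * ((\<Sum>j\<in>UNIV. (lam j)\<^sup>2 * ?E (\<lambda>\<omega>. (z t j \<omega>)\<^sup>2)) + 2 * (lam i)\<^sup>2 * ?E (\<lambda>\<omega>. (z t i \<omega>)\<^sup>2)))"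
    by (intro has_bochner_integral_add has_bochner_integral_diff has_bochner_integral_mult_right
        cross adapted_drift dz grad2 has_bochner_integral_integrable d2)
  moreover have "(drift t i \<omega>)\<^sup>2 - 2 * eta * (drift t i \<omega> * grad t i \<omega>) + eta\<^sup>2 * (grad t i \<omega>)\<^sup>2
      = (z (Suc t) i \<omega>)\<^sup>2" for \<omega>
    unfolding z_Suc power2_diff power_mult_distrib[of eta] by simp
  ultimately show ?goal1 by (simp only:)
  have "has_bochner_integral gauss_space
      (\<lambda>\<omega>. drift t i \<omega> * z t i \<omega> - eta * (z t i \<omega> * grad t i \<omega>))
      (?E (\<lambda>\<omega>. drift t i \<omega> * z t i \<omega>) - eta * (lam i * ?E (\<lambda>\<omega>. z t i \<omega> * z t i \<omega>)))"
    by (intro has_bochner_integral_diff has_bochner_integral_mult_right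
        cross adapted_z zz has_bochner_integral_integrable dz)
  moreover have "drift t i \<omega> * z t i \<omega> - eta * (z t i \<omega> * grad t i \<omega>) = z (Suc t) i \<omega> * z t i \<omega>" for \<omega>
    unfolding z_Suc by (simp add: left_diff_distrib)
  ultimately show ?goal2 unfolding power2_eq_square by (simp only:)
qed

lemma square_integrable:
  "integrable gauss_space (\<lambda>\<omega>. (z t i \<omega>)\<^sup>2) \<and> integrable gauss_space (\<lambda>\<omega>. (y t i \<omega>)\<^sup>2)"
proof (induction t arbitrary: i)
  case 0
  show ?case by (simp add: z_0 y_0)
next
  case (Suc t)
  then show ?case using z_Suc_square(1)[of t i] by (auto simp: y_Suc has_bochner_integral_iff)
qed

lemmas z_square_integrable = square_integrable[THEN conjunct1]
  and y_square_integrable = square_integrable[THEN conjunct2]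

lemma z_y_integrable: "integrable gauss_space (\<lambda>\<omega>. z t i \<omega> * y t i \<omega>)"
  by (rule integrable_mult_of_squares) (auto simp: z_square_integrable y_square_integrable)

section \<open>First and second moments and their recursions\<close>

definition "Ez t i = (\<integral>\<omega>. z t i \<omega> \<partial>gauss_space)"
definition "Ey t i = (\<integral>\<omega>. y t i \<omega> \<partial>gauss_space)"
definition "Ezz t i = (\<integral>\<omega>. (z t i \<omega>)\<^sup>2 \<partial>gauss_space)"
definition "Ezy t i = (\<integral>\<omega>. z t i \<omega> * y t i \<omega> \<partial>gauss_space)"
definition "Eyy t i = (\<integral>\<omega>. (y t i \<omega>)\<^sup>2 \<partial>gauss_space)"

lemma z_integrable: "integrable gauss_space (z t i)" and y_integrable: "integrable gauss_space (y t i)"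
  using integrable_mult_of_squares[of "z t i" gauss_space "\<lambda>_. 1"]
    integrable_mult_of_squares[of "y t i" gauss_space "\<lambda>_. 1"]
  by (auto simp: z_square_integrable y_square_integrable)

lemma moments_0:
  "Ez 0 i = x i" "Ey 0 i = x i" "Ezz 0 i = (x i)\<^sup>2" "Ezy 0 i = (x i)\<^sup>2" "Eyy 0 i = (x i)\<^sup>2"
  using gauss.prob_space
  by (auto simp: Ez_def Ey_def Ezz_def Ezy_def Eyy_def z_0 y_0 power2_eq_square)

lemma Ey_Suc: "Ey (Suc t) i = Ez t i" and Eyy_Suc: "Eyy (Suc t) i = Ezz t i"
  by (simp_all add: Ey_def Ez_def Ezz_def Eyy_def y_Suc)

text \<open>The gradient estimate is unbiased: the fresh direction has identity covariance and is
  independent of \<open>z t\<close>. Hence the means follow deterministic heavy ball, with no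
  coupling between components.\<close>

lemma Ez_Suc: "Ez (Suc t) i = (1 + beta - eta * lam i) * Ez t i - beta * Ey t i"
proof -
  let ?v = "\<lambda>j \<omega>. q j \<bullet> gauss_dirs \<omega> t"
  have "has_bochner_integral gauss_space
      (\<lambda>\<omega>. (1 + beta) * z t i \<omega> - beta * y t i \<omega> - eta * (\<Sum>j\<in>UNIV. lam j * (z t j \<omega> * (?v i \<omega> * ?v j \<omega>))))
      ((1 + beta) * Ez t i - beta * Ey t i - eta * (\<Sum>j\<in>UNIV. lam j * (Ez t j * (q i \<bullet> q j))))"
    unfolding Ez_def Ey_def
    by (intro has_bochner_integral_sum has_bochner_integral_mult_right has_bochner_integral_diff
          adapted_mult_fresh[where h="\<lambda>u. (q i \<bullet> u) * (q _ \<bullet> u)"] adapted_z gauss_second_moment z_integrable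
          has_bochner_integral_integrable y_integrable)
  moreover have "(1 + beta) * z t i \<omega> - beta * y t i \<omega> - eta * (\<Sum>j\<in>UNIV. lam j * (z t j \<omega> * (?v i \<omega> * ?v j \<omega>)))
      = z (Suc t) i \<omega>" for \<omega>
    unfolding z_Suc by (simp add: sum_distrib_left algebra_simps)
  moreover have "(\<Sum>j\<in>UNIV. lam j * (Ez t j * (q i \<bullet> q j))) = lam i * Ez t i"
    by (simp add: orthonormal if_distrib cong: if_cong)
  ultimately have "Ez (Suc t) i = (1 + beta) * Ez t i - beta * Ey t i - eta * (lam i * Ez t i)"
    unfolding Ez_def[of "Suc t"] by (auto simp: has_bochner_integral_iff)
  then show ?thesis by (simp add: algebra_simps)
qed

text \<open>Isserlis' formula gives \<open>2 * (eta * lam i)^2\<close> times \<open>Ezz t i\<close>.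
  One copy completes the square of \<open>1 + beta - eta * lam i\<close>; the other stays as a
  separate noise term beside the common sum.\<close>

lemma Ezy_Suc: "Ezy (Suc t) i = (1 + beta - eta * lam i) * Ezz t i - beta * Ezy t i"
  and Ezz_Suc: "Ezz (Suc t) i = (1 + beta - eta * lam i)\<^sup>2 * Ezz t i - 2 * (1 + beta - eta * lam i) * beta * Ezy t i
      + beta\<^sup>2 * Eyy t i + (eta * lam i)\<^sup>2 * Ezz t i + (\<Sum>j\<in>UNIV. (eta * lam j)\<^sup>2 * Ezz t j)"
proof -
  note S = z_Suc_square[OF z_square_integrable y_square_integrable, of t i]
  have dz: "(\<integral>\<omega>. drift t i \<omega> * z t i \<omega> \<partial>gauss_space) = (1 + beta) * Ezz t i - beta * Ezy t i"
  proof -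
    have "(\<integral>\<omega>. drift t i \<omega> * z t i \<omega> \<partial>gauss_space)
        = (\<integral>\<omega>. (1 + beta) * (z t i \<omega>)\<^sup>2 - beta * (z t i \<omega> * y t i \<omega>) \<partial>gauss_space)"
      by (rule Bochner_Integration.integral_cong) (auto simp: algebra_simps power2_eq_square)
    then show ?thesis
      using z_square_integrable z_y_integrable by (simp add: Ezz_def Ezy_def)
  qed
  have d2: "(\<integral>\<omega>. (drift t i \<omega>)\<^sup>2 \<partial>gauss_space)
      = (1 + beta)\<^sup>2 * Ezz t i - 2 * (1 + beta) * beta * Ezy t i + beta\<^sup>2 * Eyy t i"
  proof -
    have "(\<integral>\<omega>. (drift t i \<omega>)\<^sup>2 \<partial>gauss_space)
        = (\<integral>\<omega>. (1 + beta)\<^sup>2 * (z t i \<omega>)\<^sup>2 - (2 * (1 + beta) * beta) * (z t i \<omega> * y t i \<omega>) + beta\<^sup>2 * (y t i \<omega>)\<^sup>2 \<partial>gauss_space)"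
      by (rule Bochner_Integration.integral_cong) (auto simp: algebra_simps power2_eq_square)
    then show ?thesis
      using z_square_integrable z_y_integrable y_square_integrable by (simp add: Ezz_def Ezy_def Eyy_def)
  qed
  show "Ezy (Suc t) i = (1 + beta - eta * lam i) * Ezz t i - beta * Ezy t i"
    using S(2) unfolding dz Ezz_def[symmetric]
    by (simp add: Ezy_def[of "Suc t"] y_Suc has_bochner_integral_iff algebra_simps)
  have "Ezz (Suc t) i = (1 + beta)\<^sup>2 * Ezz t i - 2 * (1 + beta) * beta * Ezy t i + beta\<^sup>2 * Eyy t i
      - 2 * eta * (lam i * ((1 + beta) * Ezz t i - beta * Ezy t i))
      + eta\<^sup>2 * ((\<Sum>j\<in>UNIV. (lam j)\<^sup>2 * Ezz t j) + 2 * (lam i)\<^sup>2 * Ezz t i)"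
    using S(1) unfolding dz d2 Ezz_def[symmetric]
    by (simp add: Ezz_def[of "Suc t"] has_bochner_integral_iff)
  then show "Ezz (Suc t) i = (1 + beta - eta * lam i)\<^sup>2 * Ezz t i - 2 * (1 + beta - eta * lam i) * beta * Ezy t i
      + beta\<^sup>2 * Eyy t i + (eta * lam i)\<^sup>2 * Ezz t i + (\<Sum>j\<in>UNIV. (eta * lam j)\<^sup>2 * Ezz t j)"
    by (simp add: power_mult_distrib sum_distrib_left algebra_simps power2_eq_square)
qed

lemma quadratic_moment:
  "(\<integral>\<omega>. (a * z t i \<omega> + b * y t i \<omega>)\<^sup>2 \<partial>gauss_space) = a\<^sup>2 * Ezz t i + 2 * a * b * Ezy t i + b\<^sup>2 * Eyy t i"
proof -
  have "(\<integral>\<omega>. (a * z t i \<omega> + b * y t i \<omega>)\<^sup>2 \<partial>gauss_space)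
      = (\<integral>\<omega>. a\<^sup>2 * (z t i \<omega>)\<^sup>2 + (2 * a * b) * (z t i \<omega> * y t i \<omega>) + b\<^sup>2 * (y t i \<omega>)\<^sup>2 \<partial>gauss_space)"
    by (rule Bochner_Integration.integral_cong) (auto simp: algebra_simps power2_eq_square)
  then show ?thesis
    using z_square_integrable z_y_integrable y_square_integrable by (simp add: Ezz_def Ezy_def Eyy_def)
qed

text \<open>The matrix of second moments is positive semidefinite. Together with the recursions,
  this is all that the stability analysis retains of the process.\<close>

lemma quadratic_moment_nonneg: "0 \<le> a\<^sup>2 * Ezz t i + 2 * a * b * Ezy t i + b\<^sup>2 * Eyy t i"
  unfolding quadratic_moment[symmetric] by simp

end

section \<open>Stability of the moment recursions\<close>

lemma heavy_ball_bounded: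
  fixes m n :: "nat \<Rightarrow> real"
  assumes rec: "\<And>t. m (Suc t) = (1 + b - a) * m t - b * n t" "\<And>t. n (Suc t) = m t"
    and "m 0 = n 0" "0 \<le> b" "b < 1" "0 \<le> a" "a < 2 * (1 + b)"
  shows "\<exists>B. \<forall>t. \<bar>m t\<bar> \<le> B"
proof (cases "a = 0")
  \<comment> \<open>For \<open>a = 0\<close> the Lyapunov function below no longer controls
    \<open>m\<close> alone; instead the equal initial values make the sequence constant.\<close>
  case True
  have "m t = m 0 \<and> n t = m 0" for t
    by (induction t) (use \<open>m 0 = n 0\<close> True in \<open>simp_all add: rec algebra_simps\<close>)
  then show ?thesis by (metis order_refl)
next
  case False
  \<comment> \<open>This is the value with \<open>1 + b - a = th * (1 + b)\<close>. With it the
    coefficients of \<open>m t * n t\<close> and of the square of \<open>n t\<close> are the same in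
    \<open>V (Suc t)\<close> and \<open>V t\<close>, so the change of \<open>V\<close> involves only
    the square of \<open>m t\<close>.\<close>
  define th where "th = 1 - a / (1 + b)"
  define V where "V t = (m t)\<^sup>2 - 2 * th * b * m t * n t + b\<^sup>2 * (n t)\<^sup>2" for t
  have th2: "th\<^sup>2 < 1"
  proof -
    have "0 < a / (1 + b)" "a / (1 + b) < 2"
      using assms False by (auto simp: field_simps)
    then have "\<bar>th\<bar> < 1" by (auto simp: th_def)
    then show ?thesis by (simp add: abs_square_less_1)
  qed
  have p: "1 + b - a = th * (1 + b)"
    using assms by (simp add: th_def field_simps)
  have V_dec: "V (Suc t) \<le> V t" for t
  proof -
    have "V (Suc t) = V t - (1 - b\<^sup>2) * (1 - th\<^sup>2) * (m t)\<^sup>2"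
      unfolding V_def rec p by (simp add: power2_eq_square algebra_simps)
    moreover have "0 \<le> (1 - b\<^sup>2) * (1 - th\<^sup>2) * (m t)\<^sup>2"
      using th2 assms by (intro mult_nonneg_nonneg) (auto simp: power_le_one)
    ultimately show ?thesis by simp
  qed
  have "V t \<le> V 0" for t
    by (induction t) (use V_dec order_trans in blast)+
  moreover have "(1 - th\<^sup>2) * (m t)\<^sup>2 \<le> V t" for t
  proof -
    have "V t - (1 - th\<^sup>2) * (m t)\<^sup>2 = (th * m t - b * n t)\<^sup>2"
      unfolding V_def by (simp add: power2_eq_square algebra_simps)
    then show ?thesis using zero_le_power2[of "th * m t - b * n t"] by linarith
  qed
  ultimately have "(m t)\<^sup>2 \<le> V 0 / (1 - th\<^sup>2)" for t
    using th2 by (simp add: pos_le_divide_eq mult.commute) (meson order_trans)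
  then have "\<bar>m t\<bar> \<le> sqrt (V 0 / (1 - th\<^sup>2))" for t
    by (metis real_sqrt_abs real_sqrt_le_mono)
  then show ?thesis by blast
qed

text \<open>Beyond the threshold the sequence alternates in sign. Multiplying by
  \<open>(-1) ^ t\<close> removes the alternation and leaves a sequence that grows at least
  linearly.\<close>

lemma heavy_ball_unbounded:
  fixes m n :: "nat \<Rightarrow> real"
  assumes rec: "\<And>t. m (Suc t) = (1 + b - a) * m t - b * n t" "\<And>t. n (Suc t) = m t"
    and init: "m 0 = 1" "n 0 = 1" and b: "0 \<le> b" "b < 1" and a: "2 * (1 + b) < a"
  shows "\<not> (\<exists>B. \<forall>t. \<bar>m t\<bar> \<le> B)"
proof
  assume "\<exists>B. \<forall>t. \<bar>m t\<bar> \<le> B"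
  then obtain B where B: "\<And>t. \<bar>m t\<bar> \<le> B" by blast
  define d where "d = a - 2 * (1 + b)"
  define r where "r t = (-1) ^ t * m t" for t
  \<comment> \<open>The extra minus sign accounts for the lag of \<open>n\<close> behind
    \<open>m\<close> and makes \<open>s (Suc t) = r t\<close>.\<close>
  define s where "s t = - ((-1) ^ t * n t)" for t
  have rS: "r (Suc t) = (1 + b + d) * r t - b * s t" "s (Suc t) = r t" for t
    by (simp_all add: r_def s_def rec d_def algebra_simps)
  \<comment> \<open>The second conjunct makes \<open>b * (r t - s t)\<close> nonnegative, so each
    step adds at least \<open>d * r t\<close>, which is at least \<open>d\<close>.\<close>
  have inv: "1 + real t * d \<le> r t \<and> s t \<le> r t" for t
  proof (induction t)
    case 0
    show ?case using init by (simp add: r_def s_def)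
  next
    case (Suc t)
    have "1 \<le> r t" using Suc a d_def by (smt (verit) mult_nonneg_nonneg of_nat_0_le_iff)
    then have "d \<le> d * r t" using a d_def by simp
    moreover have "0 \<le> b * (r t - s t)" using Suc b by simp
    ultimately have "r t + d \<le> r (Suc t)" by (simp add: rS algebra_simps)
    moreover have "0 < d" using a by (simp add: d_def)
    ultimately show ?case using Suc by (simp add: rS(2) algebra_simps)
  qed
  obtain t :: nat where "B < real t * d"
    using reals_Archimedean3[of d] a d_def by auto
  then have "B < r t" using inv[of t] by simp
  moreover have "\<bar>r t\<bar> = \<bar>m t\<bar>" by (simp add: r_def abs_mult power_abs)
  ultimately show False using B[of t] by linarith
qed

section \<open>The coupled second-moment system and its Lyapunov function\<close>

locale second_moments =
  fixes a :: "'n::finite \<Rightarrow> real" and b :: real and X Y W :: "nat \<Rightarrow> 'n \<Rightarrow> real"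
  assumes X_Suc: "X (Suc t) i = (1 + b - a i)\<^sup>2 * X t i - 2 * (1 + b - a i) * b * Y t i
      + b\<^sup>2 * W t i + (a i)\<^sup>2 * X t i + (\<Sum>j\<in>UNIV. (a j)\<^sup>2 * X t j)"
    and Y_Suc: "Y (Suc t) i = (1 + b - a i) * X t i - b * Y t i"
    and W_Suc: "W (Suc t) i = X t i"
    and psd: "0 \<le> c\<^sup>2 * X t i + 2 * c * d * Y t i + d\<^sup>2 * W t i"
    and b_nonneg: "0 \<le> b" and b_less_1: "b < 1" and a_nonneg: "0 \<le> a i"
begin

definition "S t = (\<Sum>j\<in>UNIV. (a j)\<^sup>2 * X t j)"
text \<open>The lag-one autocorrelation of a stationary autoregression of order two with
  coefficients \<open>1 + b - a i\<close> and \<open>- b\<close>.\<close>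

definition "th i = 1 - a i / (1 + b)"
definition "V t i = X t i - 2 * th i * b * Y t i + b\<^sup>2 * W t i"
definition "w i = a i / (2 * (1 - b) * (1 - a i / (1 - b\<^sup>2)))"

lemma X_nonneg: "0 \<le> X t i" and W_nonneg: "0 \<le> W t i"
  using psd[of 1 t i 0] psd[of 0 t i 1] by simp_all

lemma S_nonneg: "0 \<le> S t"
  unfolding S_def by (intro sum_nonneg mult_nonneg_nonneg X_nonneg) simp

lemma X_le_S: "(a i)\<^sup>2 * X t i \<le> S t"
  unfolding S_def by (rule member_le_sum) (auto simp: X_nonneg)

text \<open>The choice of \<open>th i\<close> makes the \<open>Y\<close> and \<open>W\<close> terms
  of \<open>V\<close> reproduce themselves. What remains is the deterministic dissipation
  \<open>(1 - b^2) * (1 - (th i)^2)\<close> reduced by the component's own noise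
  \<open>(a i)^2\<close>, plus the common noise \<open>S t\<close>. In factored form the net
  dissipation is visibly positive exactly for \<open>0 < a i < 1 - b^2\<close>.\<close>

lemma V_Suc: "V (Suc t) i = V t i - 2 * (1 - b) * a i * (1 - a i / (1 - b\<^sup>2)) * X t i + S t"
proof -
  have nz: "1 + b \<noteq> 0" "1 - b \<noteq> 0" using b_nonneg b_less_1 by auto
  have p: "1 + b - a i = th i * (1 + b)" using nz by (simp add: th_def field_simps)
  have ai: "a i = (1 - th i) * (1 + b)" using nz by (simp add: th_def)
  have b2: "1 - b\<^sup>2 = (1 - b) * (1 + b)" by (simp add: power2_eq_square algebra_simps)
  have r: "a i / (1 - b\<^sup>2) = (1 - th i) / (1 - b)" unfolding b2 using nz ai by simp
  have "2 * (1 - b) * a i * (1 - a i / (1 - b\<^sup>2)) = 2 * a i * (th i - b)"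
    unfolding r using nz by (simp add: field_simps)
  also have "\<dots> = (1 - b\<^sup>2) * (1 - (th i)\<^sup>2) - (a i)\<^sup>2"
    unfolding ai by (simp add: power2_eq_square algebra_simps)
  finally have k: "2 * (1 - b) * a i * (1 - a i / (1 - b\<^sup>2)) = (1 - b\<^sup>2) * (1 - (th i)\<^sup>2) - (a i)\<^sup>2" .
  show ?thesis
    unfolding k unfolding V_def X_Suc Y_Suc W_Suc S_def p
    by (simp add: power2_eq_square algebra_simps)
qed

text \<open>Completing the square: the difference of the two sides is the second moment of
  \<open>th i * z - b * y\<close>.\<close>

lemma V_ge: "(1 - (th i)\<^sup>2) * X t i \<le> V t i"
  using psd[of "th i" t i "- b"] unfolding V_def by (simp add: algebra_simps)

lemma abs_Y_le: "\<bar>Y t i\<bar> \<le> X t i + W t i"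
  using psd[of 1 t i 1] psd[of 1 t i "-1"] X_nonneg[of t i] W_nonneg[of t i] by simp

lemma one_minus_b_square: "0 < 1 - b\<^sup>2"
  using b_nonneg b_less_1 by (simp add: abs_square_less_1)

lemma ratio_less_1: "a i < 1 - b\<^sup>2 \<Longrightarrow> a i / (1 - b\<^sup>2) < 1"
  using one_minus_b_square by (simp add: divide_less_eq)

lemma weighted_V_Suc:
  assumes "\<And>i. a i < 1 - b\<^sup>2"
  shows "(\<Sum>i\<in>UNIV. w i * V (Suc t) i) = (\<Sum>i\<in>UNIV. w i * V t i) + (sum w UNIV - 1) * S t"
proof -
  \<comment> \<open>The weight turns the dissipation coefficient of \<open>V_Suc\<close> into
    \<open>(a i)^2\<close>, the coefficient of \<open>X t i\<close> in \<open>S t\<close>.\<close>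
  have "w i * (2 * (1 - b) * a i * (1 - a i / (1 - b\<^sup>2))) = (a i)\<^sup>2" for i
  proof -
    have cancel: "r \<noteq> 0 \<Longrightarrow> u \<noteq> 0 \<Longrightarrow> v / (2 * u * r) * (2 * u * v * r) = v\<^sup>2" for r u v :: real
      by (simp add: power2_eq_square)
    show ?thesis unfolding w_def
      by (rule cancel) (use ratio_less_1[OF assms, of i] b_less_1 in linarith)+
  qed
  then have "w i * V (Suc t) i = w i * V t i - (a i)\<^sup>2 * X t i + w i * S t" for i
    unfolding V_Suc by (simp add: distrib_left right_diff_distrib mult.assoc[symmetric])
  then have "(\<Sum>i\<in>UNIV. w i * V (Suc t) i) = (\<Sum>i\<in>UNIV. w i * V t i) - S t + sum w UNIV * S t"
    by (simp add: sum.distrib sum_subtractf S_def sum_distrib_right)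
  then show ?thesis by (simp add: algebra_simps)
qed

text \<open>The weighted functional stays nonnegative and loses a fixed multiple of
  \<open>S t\<close> in each step, so \<open>S\<close> has bounded partial sums. Each
  \<open>V t i\<close> grows by at most \<open>S t\<close> per step and is therefore bounded; for
  \<open>a i > 0\<close> it dominates a positive multiple of \<open>X t i\<close>.\<close>

lemma bounded_below_threshold:
  assumes a: "\<And>i. a i < 1 - b\<^sup>2" and w: "sum w UNIV < 1"
  shows "\<exists>B. \<forall>t. X t i \<le> B"
proof -
  define L where "L t = (\<Sum>i\<in>UNIV. w i * V t i)" for t
  have th: "0 \<le> th i" "th i \<le> 1" "a i > 0 \<Longrightarrow> (th i)\<^sup>2 < 1" for i
  proof -
    have "a i < 1 + b" using a[of i] b_nonneg by (smt (verit) zero_le_power2)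
    then show "0 \<le> th i" "th i \<le> 1" using b_nonneg a_nonneg[of i] by (auto simp: th_def field_simps)
    then show "(th i)\<^sup>2 < 1" if "a i > 0"
      using that b_nonneg by (auto simp: abs_square_less_1 th_def)
  qed
  have V_nonneg: "0 \<le> V t i" for t i
  proof -
    have "0 \<le> (1 - (th i)\<^sup>2) * X t i"
      using th[of i] by (intro mult_nonneg_nonneg X_nonneg) (simp add: power_le_one)
    then show ?thesis using V_ge[of i t] by linarith
  qed
  have w_nonneg: "0 \<le> w i" for i
  proof -
    have "a i / (1 - b\<^sup>2) < 1" using ratio_less_1 a by blast
    then show ?thesis unfolding w_def using a_nonneg[of i] b_less_1 by simp
  qed
  have L_nonneg: "0 \<le> L t" for t
    unfolding L_def by (intro sum_nonneg mult_nonneg_nonneg w_nonneg V_nonneg)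
  have L: "L t + (1 - sum w UNIV) * (\<Sum>s<t. S s) = L 0" for t
  proof (induction t)
    case (Suc t)
    then show ?case using weighted_V_Suc[OF a, of t] unfolding L_def by (simp add: algebra_simps)
  qed simp
  define K where "K = L 0 / (1 - sum w UNIV)"
  have S_sum: "(\<Sum>s<t. S s) \<le> K" for t
  proof -
    have "(1 - sum w UNIV) * (\<Sum>s<t. S s) \<le> L 0" using L[of t] L_nonneg[of t] by linarith
    then show ?thesis using w by (simp add: K_def pos_le_divide_eq mult.commute)
  qed
  have V_le: "V t i \<le> V 0 i + K" for t
  proof -
    have "V t i \<le> V 0 i + (\<Sum>s<t. S s)"
    proof (induction t)
      case (Suc t)
      have "a i / (1 - b\<^sup>2) < 1" using ratio_less_1 a by blast
      then have "0 \<le> 2 * (1 - b) * a i * (1 - a i / (1 - b\<^sup>2)) * X t i"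
        using a_nonneg[of i] b_less_1 X_nonneg[of t i] by simp
      then show ?case using Suc by (simp add: V_Suc)
    qed simp
    then show ?thesis using S_sum[of t] by linarith
  qed
  show ?thesis
  proof (cases "a i = 0")
    case False
    then have "0 < 1 - (th i)\<^sup>2" using th(3)[of i] a_nonneg[of i] by simp
    moreover have "(1 - (th i)\<^sup>2) * X t i \<le> V 0 i + K" for t
      using V_ge[of i t] V_le[of t] by linarith
    ultimately have "X t i \<le> (V 0 i + K) / (1 - (th i)\<^sup>2)" for t
      by (simp add: pos_le_divide_eq mult.commute)
    then show ?thesis by blast
  next
    case True
    \<comment> \<open>Here \<open>V t i\<close> only controls the increment \<open>z - b y\<close>; convexity of the square gives a contraction for \<open>z\<close>.\<close>
    define B where "B = max (X 0 i) ((V 0 i + K) / (1 - b)\<^sup>2)"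
    have VK: "V 0 i + K \<le> (1 - b)\<^sup>2 * B" 
    proof -
      have "(V 0 i + K) / (1 - b)\<^sup>2 \<le> B" by (simp add: B_def)
      then show ?thesis using b_less_1 by (simp add: pos_divide_le_eq mult.commute)
    qed
    have thi: "th i = 1" using True by (simp add: th_def)
    have "X t i \<le> B" for t
    proof (induction t)
      case 0
      show ?case by (simp add: B_def)
    next
      case (Suc t)
      have V': "V (Suc t) i = X (Suc t) i - 2 * b * Y (Suc t) i + b\<^sup>2 * X t i"
        by (simp add: V_def thi W_Suc)
      have "0 \<le> b * (X (Suc t) i - 2 * Y (Suc t) i + X t i)"
        using psd[of 1 "Suc t" i "-1"] b_nonneg by (simp add: W_Suc)
      then have "(1 - b) * X (Suc t) i \<le> V (Suc t) i + (1 - b) * b * X t i"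
        unfolding V' by (simp add: algebra_simps power2_eq_square)
      \<comment> \<open>The bound \<open>B\<close> reproduces itself because
        \<open>(1 - b)^2 + (1 - b) * b = 1 - b\<close>.\<close>
      also have "\<dots> \<le> (1 - b)\<^sup>2 * B + (1 - b) * b * B"
        using V_le[of "Suc t"] VK Suc b_nonneg b_less_1
        by (intro add_mono mult_left_mono) auto
      also have "\<dots> = (1 - b) * B" by (simp add: power2_eq_square algebra_simps)
      finally show ?case using b_less_1 by simp
    qed
    then show ?thesis by blast
  qed
qed

text \<open>If all second moments stayed bounded, the monotone functional would converge, which forces
  \<open>S t\<close> and hence the functional itself to tend to zero.\<close>

lemma unbounded_of_increasing_functional:
  assumes c: "\<And>i. a i = 0 \<Longrightarrow> c i = 0" and "0 < d"
    and inc: "\<And>t. (\<Sum>i\<in>UNIV. c i * V t i) + d * S t \<le> (\<Sum>i\<in>UNIV. c i * V (Suc t) i)"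
    and pos: "0 < (\<Sum>i\<in>UNIV. c i * V 0 i)"
  shows "\<not> (\<exists>B. \<forall>t i. X t i \<le> B)"
proof
  assume "\<exists>B. \<forall>t i. X t i \<le> B"
  then obtain B where B: "\<And>t i. X t i \<le> B" by blast
  define L where "L t = (\<Sum>i\<in>UNIV. c i * V t i)" for t
  have L_inc: "L t + d * S t \<le> L (Suc t)" for t using inc by (simp add: L_def)
  have "incseq L"
    using L_inc S_nonneg \<open>0 < d\<close> by (intro incseq_SucI) (smt (verit) mult_nonneg_nonneg)
  \<comment> \<open>The bounds are stated from time one on: \<open>W\<close> is then an earlier
    \<open>X\<close>, whereas \<open>W 0\<close> is not covered by \<open>B\<close>.\<close>
  have W_le: "W (Suc t) i \<le> B" for t i by (simp add: W_Suc B)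
  have V_bound: "\<bar>V (Suc t) i\<bar> \<le> B + 2 * \<bar>th i\<bar> * b * (B + B) + b\<^sup>2 * B" for t i
  proof -
    have "\<bar>V (Suc t) i\<bar> \<le> \<bar>X (Suc t) i\<bar> + \<bar>2 * th i * b * Y (Suc t) i\<bar> + \<bar>b\<^sup>2 * W (Suc t) i\<bar>"
      unfolding V_def by linarith
    also have "\<dots> = X (Suc t) i + 2 * \<bar>th i\<bar> * b * \<bar>Y (Suc t) i\<bar> + b\<^sup>2 * W (Suc t) i"
      using X_nonneg W_nonneg b_nonneg by (simp add: abs_mult)
    also have "\<dots> \<le> B + 2 * \<bar>th i\<bar> * b * (B + B) + b\<^sup>2 * B"
      using b_nonneg abs_Y_le[of "Suc t" i] B[of "Suc t" i] W_le[of t i]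
      by (intro add_mono mult_left_mono) auto
    finally show ?thesis .
  qed
  have "L (Suc t) \<le> (\<Sum>i\<in>UNIV. \<bar>c i\<bar> * (B + 2 * \<bar>th i\<bar> * b * (B + B) + b\<^sup>2 * B))" for t
  proof -
    have "c i * V (Suc t) i \<le> \<bar>c i\<bar> * \<bar>V (Suc t) i\<bar>" for i
      by (metis abs_ge_self abs_mult)
    then show ?thesis
      unfolding L_def by (intro sum_mono) (meson V_bound abs_ge_zero mult_left_mono order_trans)
  qed
  then have "L t \<le> (\<Sum>i\<in>UNIV. \<bar>c i\<bar> * (B + 2 * \<bar>th i\<bar> * b * (B + B) + b\<^sup>2 * B))" for t
    using incseq_SucD[OF \<open>incseq L\<close>, of t] by (rule order_trans[rotated])
  then obtain l where l: "L \<longlonglongrightarrow> l"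
    using incseq_convergent[OF \<open>incseq L\<close>] by blast
  have "(\<lambda>t. (L (Suc t) - L t) / d) \<longlonglongrightarrow> (l - l) / d"
    by (intro tendsto_intros LIMSEQ_Suc l) (use \<open>0 < d\<close> in auto)
  moreover have "S t \<le> (L (Suc t) - L t) / d" for t
    using L_inc[of t] \<open>0 < d\<close> by (simp add: pos_le_divide_eq mult.commute)
  ultimately have S0: "S \<longlonglongrightarrow> 0"
    by (intro tendsto_sandwich[of "\<lambda>_. 0" S sequentially "\<lambda>t. (L (Suc t) - L t) / d"]) (auto simp: S_nonneg)
  \<comment> \<open>Components with \<open>a i = 0\<close> do not enter \<open>S\<close>, so its
    decay says nothing about them; they are excluded by \<open>c i = 0\<close>. For all others
    \<open>X t i\<close> is at most \<open>S t\<close> divided by \<open>(a i)^2\<close>.\<close>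
  have cV0: "(\<lambda>t. c i * V (Suc t) i) \<longlonglongrightarrow> 0" for i
  proof (cases "a i = 0")
    case True
    then show ?thesis using c by simp
  next
    case False
    have "(\<lambda>t. S t / (a i)\<^sup>2) \<longlonglongrightarrow> 0 / (a i)\<^sup>2"
      by (intro tendsto_intros S0) (use False in auto)
    moreover have "X t i \<le> S t / (a i)\<^sup>2" for t
      using X_le_S[of i t] False by (simp add: pos_le_divide_eq mult.commute)
    ultimately have X0: "(\<lambda>t. X t i) \<longlonglongrightarrow> 0"
      by (intro tendsto_sandwich[of "\<lambda>_. 0" "\<lambda>t. X t i" sequentially "\<lambda>t. S t / (a i)\<^sup>2"]) (auto simp: X_nonneg)
    have XS0: "(\<lambda>t. X (Suc t) i) \<longlonglongrightarrow> 0" using X0 by (rule LIMSEQ_Suc)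
    have "(\<lambda>t. X (Suc t) i + X t i) \<longlonglongrightarrow> 0 + 0" by (intro tendsto_intros X0 XS0)
    then have Y0: "(\<lambda>t. Y (Suc t) i) \<longlonglongrightarrow> 0"
      using abs_Y_le[of "Suc _" i]
      by (intro Lim_null_comparison[of "\<lambda>t. Y (Suc t) i" "\<lambda>t. X (Suc t) i + X t i"]) (auto simp: W_Suc)
    have "(\<lambda>t. c i * V (Suc t) i) \<longlonglongrightarrow> c i * (0 - 2 * th i * b * 0 + b\<^sup>2 * 0)"
      unfolding V_def W_Suc by (intro tendsto_intros X0 XS0 Y0)
    then show ?thesis by simp
  qed
  have "(\<lambda>t. L (Suc t)) \<longlonglongrightarrow> (\<Sum>i\<in>(UNIV::'n set). 0)"
    unfolding L_def by (intro tendsto_sum cV0)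
  then have "(\<lambda>t. L (Suc t)) \<longlonglongrightarrow> 0" by simp
  moreover have "L 0 \<le> L (Suc t)" for t using \<open>incseq L\<close> by (simp add: incseq_def)
  ultimately have "L 0 \<le> 0" by (meson LIMSEQ_le_const)
  then show False using pos by (simp add: L_def)
qed

text \<open>The start lies in the leading component \<open>k\<close>. If \<open>a k\<close> reaches
  \<open>1 - b^2\<close>, the dissipation of that component is nonpositive and \<open>V t k\<close>
  alone increases by at least \<open>S t\<close>. Otherwise all weights are well defined and the
  weighted sum increases by \<open>(sum w UNIV - 1) * S t\<close>.\<close>

lemma unbounded_above_threshold:
  assumes init: "\<And>i. X 0 i = (if i = k then 1 else 0)" "\<And>i. Y 0 i = (if i = k then 1 else 0)"
      "\<And>i. W 0 i = (if i = k then 1 else 0)"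
    and k: "\<And>i. a i \<le> a k" "0 < a k"
    and cond: "1 - b\<^sup>2 \<le> a k \<or> 1 < sum w UNIV"
  shows "\<not> (\<exists>B. \<forall>t i. X t i \<le> B)"
proof -
  have V0: "V 0 i = (if i = k then 1 - 2 * th k * b + b\<^sup>2 else 0)" for i
    by (simp add: V_def init)
  \<comment> \<open>Since \<open>th k\<close> is at most one, the initial value is at least
    \<open>(1 - b)^2\<close>.\<close>
  have V0_pos: "0 < 1 - 2 * th k * b + b\<^sup>2"
  proof -
    have "th k \<le> 1" using k(2) b_nonneg by (simp add: th_def)
    then have "th k * b \<le> 1 * b" by (intro mult_right_mono b_nonneg)
    moreover have "0 < (1 - b)\<^sup>2" using b_less_1 by simp
    ultimately show ?thesis by (simp add: power2_eq_square algebra_simps)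
  qed
  show ?thesis
  proof (cases "1 - b\<^sup>2 \<le> a k")
    case True
    have pick: "(\<Sum>i\<in>UNIV. (if i = k then 1 else 0) * V t i) = V t k" for t
      by (simp add: if_distrib[of "\<lambda>x. x * _"] cong: if_cong)
    show ?thesis
    proof (rule unbounded_of_increasing_functional[where c="\<lambda>i. if i = k then 1 else 0" and d=1])
      show "(\<Sum>i\<in>UNIV. (if i = k then 1 else 0) * V t i) + 1 * S t
          \<le> (\<Sum>i\<in>UNIV. (if i = k then 1 else 0) * V (Suc t) i)" for t
      proof -
        have "1 \<le> a k / (1 - b\<^sup>2)" using True one_minus_b_square by (simp add: le_divide_eq)
        then have "2 * (1 - b) * a k * (1 - a k / (1 - b\<^sup>2)) * X t k \<le> 0"
          using k(2) b_less_1 X_nonneg[of t k] by (simp add: mult_nonneg_nonpos mult_nonpos_nonneg)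
        then show ?thesis unfolding pick by (simp add: V_Suc)
      qed
      show "0 < (\<Sum>i\<in>UNIV. (if i = k then 1 else 0) * V 0 i)"
        unfolding pick using V0 V0_pos by simp
    qed (use k in auto)
  next
    case False
    then have a: "a i < 1 - b\<^sup>2" for i using k(1)[of i] by linarith
    have "0 < w k"
    proof -
      have "a k / (1 - b\<^sup>2) < 1" using ratio_less_1 a by blast
      then show ?thesis unfolding w_def using k(2) b_less_1 by simp
    qed
    show ?thesis
    proof (rule unbounded_of_increasing_functional[where c=w and d="sum w UNIV - 1"])
      show "(\<Sum>i\<in>UNIV. w i * V t i) + (sum w UNIV - 1) * S t \<le> (\<Sum>i\<in>UNIV. w i * V (Suc t) i)" for t
        unfolding weighted_V_Suc[OF a] by simp
      have "(\<Sum>i\<in>UNIV. w i * V 0 i) = w k * (1 - 2 * th k * b + b\<^sup>2)"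
        unfolding V0 by (simp add: if_distrib[of "\<lambda>x. _ * x"] cong: if_cong)
      then show "0 < (\<Sum>i\<in>UNIV. w i * V 0 i)" using \<open>0 < w k\<close> V0_pos by simp
    qed (use False cond in \<open>auto simp: w_def\<close>)
  qed
qed

end

section \<open>The threshold equation and the eigenbasis\<close>

text \<open>Membership of \<open>c\<close> itself is left open, so the behaviour exactly at a
  critical step size never has to be decided.\<close>

lemma Sup_eq_threshold:
  fixes A :: "real set"
  assumes "0 < c" "\<And>x. 0 < x \<Longrightarrow> x < c \<Longrightarrow> x \<in> A" "\<And>x. x \<in> A \<Longrightarrow> x \<le> c"
  shows "Sup A = c"
proof (rule cSup_eq_non_empty)
  show "A \<noteq> {}" using assms(1) assms(2)[of "c/2"] by auto
  show "c \<le> u" if "\<And>x. x \<in> A \<Longrightarrow> x \<le> u" for u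
    by (rule dense_le_bounded[OF assms(1)]) (use assms(2) that in auto)
qed (use assms in auto)

lemma Max_range_attained: "\<exists>k. (lam :: 'n::finite \<Rightarrow> real) k = Max (range lam)"
proof -
  have "Max (range lam) \<in> range lam" by (rule Max_in) auto
  then show ?thesis by (metis imageE)
qed

section \<open>The threshold sum: monotonicity, root and bounds\<close>

context
  fixes lam :: "'n::finite \<Rightarrow> real" and beta :: real
  assumes lam_nonneg: "\<And>i. 0 \<le> lam i" and lam_max_pos: "0 < Max (range lam)"
    and beta: "0 \<le> beta" "beta < 1"
begin

abbreviation (input) "ms_sum eta \<equiv> \<Sum>i\<in>UNIV. eta * lam i / (2 * (1 - beta) * (1 - eta * lam i / (1 - beta\<^sup>2)))"

lemma beta_square: "0 < 1 - beta\<^sup>2"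
  using beta by (simp add: abs_square_less_1)

lemma ratio_bounds:
  assumes "0 \<le> eta" "eta * Max (range lam) < 1 - beta\<^sup>2"
  shows "0 \<le> eta * lam i / (1 - beta\<^sup>2)" "eta * lam i / (1 - beta\<^sup>2) \<le> eta * Max (range lam) / (1 - beta\<^sup>2)"
    "eta * lam i / (1 - beta\<^sup>2) < 1"
proof -
  have "eta * lam i \<le> eta * Max (range lam)" using assms by (intro mult_left_mono) auto
  then show "eta * lam i / (1 - beta\<^sup>2) \<le> eta * Max (range lam) / (1 - beta\<^sup>2)"
    using beta_square by (intro divide_right_mono) auto
  show "0 \<le> eta * lam i / (1 - beta\<^sup>2)" using assms lam_nonneg beta_square by simp
  show "eta * lam i / (1 - beta\<^sup>2) < 1"
    using \<open>eta * lam i \<le> eta * Max (range lam)\<close> assms beta_square by (simp add: divide_less_eq)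
qed

text \<open>As the step size grows up to the first pole, numerators increase while denominators
  decrease and stay positive. Strictness comes from the largest eigenvalue, which is
  positive.\<close>

lemma ms_sum_strict_mono:
  assumes "0 \<le> e1" "e1 < e2" "e2 * Max (range lam) < 1 - beta\<^sup>2"
  shows "ms_sum e1 < ms_sum e2"
proof (rule sum_strict_mono_ex1)
  have r2: "0 < 1 - e2 * lam i / (1 - beta\<^sup>2)" for i
    using ratio_bounds[of e2 i] assms by linarith
  have r12: "1 - e2 * lam i / (1 - beta\<^sup>2) \<le> 1 - e1 * lam i / (1 - beta\<^sup>2)" for i
    using assms lam_nonneg beta_square by (simp add: divide_right_mono mult_right_mono)
  have den: "0 < 2 * (1 - beta) * (1 - e2 * lam i / (1 - beta\<^sup>2))"
    "2 * (1 - beta) * (1 - e2 * lam i / (1 - beta\<^sup>2)) \<le> 2 * (1 - beta) * (1 - e1 * lam i / (1 - beta\<^sup>2))" for i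
    using r2[of i] r12[of i] beta by (simp, intro mult_left_mono) auto
  show "\<forall>i\<in>UNIV. e1 * lam i / (2 * (1 - beta) * (1 - e1 * lam i / (1 - beta\<^sup>2)))
      \<le> e2 * lam i / (2 * (1 - beta) * (1 - e2 * lam i / (1 - beta\<^sup>2)))"
    using den assms lam_nonneg by (intro ballI frac_le) (auto intro: mult_right_mono)
  obtain k where k: "lam k = Max (range lam)"
    using Max_range_attained by metis
  have "e1 * lam k < e2 * lam k" using assms lam_max_pos k by simp
  moreover have "0 \<le> e2 * lam k" using assms lam_nonneg by simp
  ultimately have "e1 * lam k / (2 * (1 - beta) * (1 - e1 * lam k / (1 - beta\<^sup>2)))
      < e2 * lam k / (2 * (1 - beta) * (1 - e2 * lam k / (1 - beta\<^sup>2)))"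
    using den[of k] assms lam_max_pos k by (intro frac_less) auto
  then show "\<exists>i\<in>UNIV. e1 * lam i / (2 * (1 - beta) * (1 - e1 * lam i / (1 - beta\<^sup>2)))
      < e2 * lam i / (2 * (1 - beta) * (1 - e2 * lam i / (1 - beta\<^sup>2)))" by blast
qed simp

lemma ms_sum_root_exists: "\<exists>e>0. e * Max (range lam) < 1 - beta\<^sup>2 \<and> ms_sum e = 1"
proof -
  \<comment> \<open>At the ratio \<open>2/3\<close> the summand of the largest eigenvalue equals
    \<open>1 + beta\<close>, hence is at least one for every admissible \<open>beta\<close>; the
    intermediate value theorem then applies on \<open>{0..c}\<close>, safely before the first
    pole.\<close>
  define c where "c = 2/3 * (1 - beta\<^sup>2) / Max (range lam)"
  have c: "0 < c" "c * Max (range lam) = 2/3 * (1 - beta\<^sup>2)"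
    using beta_square lam_max_pos by (auto simp: c_def)
  have below: "e * Max (range lam) < 1 - beta\<^sup>2" if "e \<le> c" for e
  proof -
    have "e * Max (range lam) \<le> c * Max (range lam)" using that lam_max_pos by simp
    also have "\<dots> < 1 - beta\<^sup>2" unfolding c(2) using beta_square by simp
    finally show ?thesis .
  qed
  obtain k where k: "lam k = Max (range lam)"
    using Max_range_attained by metis
  have "1 \<le> c * lam k / (2 * (1 - beta) * (1 - c * lam k / (1 - beta\<^sup>2)))"
  proof -
    have ratio: "c * lam k / (1 - beta\<^sup>2) = 2/3" unfolding k c(2)
      using nonzero_mult_div_cancel_right[of "1 - beta\<^sup>2" "2/3"] beta_square by linarith
    have "c * lam k / (2 * (1 - beta) * (1 - c * lam k / (1 - beta\<^sup>2))) = (1 - beta\<^sup>2) / (1 - beta)"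
      unfolding ratio unfolding k c(2) using beta by (simp add: field_simps)
    also have "\<dots> = 1 + beta" using beta by (simp add: field_simps power2_eq_square)
    finally show ?thesis using beta by simp
  qed
  also have "\<dots> \<le> ms_sum c"
  proof (rule member_le_sum)
    show "0 \<le> c * lam i / (2 * (1 - beta) * (1 - c * lam i / (1 - beta\<^sup>2)))" if "i \<in> UNIV - {k}" for i
    proof -
      have "0 \<le> 1 - c * lam i / (1 - beta\<^sup>2)" using ratio_bounds[of c i] below[of c] c by linarith
      then show ?thesis using c lam_nonneg beta by simp
    qed
  qed auto
  finally have "1 \<le> ms_sum c" .
  moreover have "continuous_on {0..c} ms_sum"
  proof (intro continuous_intros ballI)
    show "2 * (1 - beta) * (1 - e * lam i / (1 - beta\<^sup>2)) \<noteq> 0" if "e \<in> {0..c}" for e i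
    proof -
      have "1 - e * lam i / (1 - beta\<^sup>2) \<noteq> 0"
      proof -
        have "e * lam i / (1 - beta\<^sup>2) < 1"
          by (rule ratio_bounds(3)) (use below that in auto)
        then show ?thesis by linarith
      qed
      then show ?thesis using beta by (simp only: mult_eq_0_iff) simp
    qed
  qed (use beta_square in auto)
  ultimately obtain e where e: "0 \<le> e" "e \<le> c" "ms_sum e = 1"
    using IVT'[of ms_sum 0 1 c] c by auto
  then have "e \<noteq> 0" by auto
  then show ?thesis using e below by (intro exI[of _ e]) auto
qed

text \<open>Every factor \<open>1 - e * lam i / (1 - beta^2)\<close> lies between its value
  \<open>1 - r\<close> at the largest eigenvalue and one. Replacing all factors by either extreme
  turns the equation into an inequality that can be solved for \<open>e\<close>.\<close>

lemma ms_sum_root_bounds: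
  assumes "0 < e" "e * Max (range lam) < 1 - beta\<^sup>2" "ms_sum e = 1"
  shows "2 * (1 - beta) / (sum lam UNIV + 2 * Max (range lam) / (1 + beta)) \<le> e"
    and "e \<le> 2 * (1 - beta) / sum lam UNIV"
proof -
  let ?M = "Max (range lam)"
  define r where "r = e * ?M / (1 - beta\<^sup>2)"
  note R = ratio_bounds[of e, folded r_def]
  have r1: "r < 1" using assms beta_square by (simp add: r_def divide_less_eq)
  obtain k where k: "lam k = ?M"
    using Max_range_attained by metis
  have tr: "0 < sum lam UNIV"
    using lam_nonneg lam_max_pos k by (intro sum_pos2[of _ k]) auto
  have "(\<Sum>i\<in>UNIV. e * lam i / (2 * (1 - beta))) \<le> ms_sum e"
  proof (rule sum_mono)
    fix i :: 'n
    have "0 \<le> e * lam i / (1 - beta\<^sup>2)" "e * lam i / (1 - beta\<^sup>2) < 1"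
      using R(1,2)[of i] r1 assms by auto
    then show "e * lam i / (2 * (1 - beta)) \<le> e * lam i / (2 * (1 - beta) * (1 - e * lam i / (1 - beta\<^sup>2)))"
      using assms lam_nonneg beta by (intro divide_left_mono) (auto simp: mult_le_cancel_left1)
  qed
  then have "e * sum lam UNIV / (2 * (1 - beta)) \<le> 1"
    using assms by (simp add: sum_distrib_left sum_divide_distrib)
  then show "e \<le> 2 * (1 - beta) / sum lam UNIV"
    using tr beta by (simp add: field_simps)
  have "ms_sum e \<le> (\<Sum>i\<in>UNIV. e * lam i / (2 * (1 - beta) * (1 - r)))"
  proof (rule sum_mono)
    fix i :: 'n
    have "1 - r \<le> 1 - e * lam i / (1 - beta\<^sup>2)" "0 < 1 - r"
      using R(2)[of i] r1 assms by auto
    then show "e * lam i / (2 * (1 - beta) * (1 - e * lam i / (1 - beta\<^sup>2))) \<le> e * lam i / (2 * (1 - beta) * (1 - r))"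
      using assms lam_nonneg beta by (intro divide_left_mono mult_left_mono mult_pos_pos) auto
  qed
  then have "1 \<le> e * sum lam UNIV / (2 * (1 - beta) * (1 - r))"
    using assms by (simp add: sum_distrib_left sum_divide_distrib)
  then have "2 * (1 - beta) * (1 - r) \<le> e * sum lam UNIV"
    using r1 beta by (simp add: pos_le_divide_eq)
  \<comment> \<open>This rewriting makes the lower estimate linear in \<open>e\<close>.\<close>
  moreover have "(1 - beta) * r = e * ?M / (1 + beta)"
  proof -
    have "1 - beta\<^sup>2 = (1 - beta) * (1 + beta)" by (simp add: power2_eq_square algebra_simps)
    then show ?thesis using beta by (simp add: r_def)
  qed
  moreover have "e * (sum lam UNIV + 2 * ?M / (1 + beta)) = e * sum lam UNIV + 2 * (e * ?M / (1 + beta))"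
    by (simp add: distrib_left)
  moreover have "2 * (1 - beta) * (1 - r) = 2 * (1 - beta) - 2 * ((1 - beta) * r)"
    by (simp add: algebra_simps)
  ultimately have "2 * (1 - beta) \<le> e * (sum lam UNIV + 2 * ?M / (1 + beta))"
    by linarith
  moreover have "0 < sum lam UNIV + 2 * ?M / (1 + beta)"
    using tr lam_max_pos beta by (simp add: add_pos_pos)
  ultimately show "2 * (1 - beta) / (sum lam UNIV + 2 * ?M / (1 + beta)) \<le> e"
    by (simp add: pos_divide_le_eq)
qed

end

section \<open>Spectral coordinates of the quadratic\<close>

locale eigenbasis =
  fixes H :: "real^'n^'n" and lam :: "'n \<Rightarrow> real" and q :: "'n \<Rightarrow> real^'n"
  assumes orthonormal: "q i \<bullet> q j = (if i = j then 1 else 0)"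
    and expand: "v = (\<Sum>i\<in>UNIV. (q i \<bullet> v) *\<^sub>R q i)"
    and eigen: "H *v q i = lam i *\<^sub>R q i"
begin

lemma mult_expand: "H *v v = (\<Sum>i\<in>UNIV. (lam i * (q i \<bullet> v)) *\<^sub>R q i)"
proof -
  have "H *v v = H *v (\<Sum>i\<in>UNIV. (q i \<bullet> v) *\<^sub>R q i)" using expand[of v] by simp
  also have "\<dots> = (\<Sum>i\<in>UNIV. (q i \<bullet> v) *\<^sub>R (H *v q i))"
    by (simp add: linear_sum[OF matrix_vector_mul_linear] matrix_vector_mult_scaleR)
  finally show ?thesis by (simp add: eigen mult.commute)
qed

lemma bilinear: "u \<bullet> (H *v v) = (\<Sum>i\<in>UNIV. lam i * (q i \<bullet> u) * (q i \<bullet> v))"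
  unfolding mult_expand by (simp add: inner_sum_right inner_commute mult_ac)

lemma norm_square: "(norm v)\<^sup>2 = (\<Sum>i\<in>UNIV. (q i \<bullet> v)\<^sup>2)"
proof -
  have "(norm v)\<^sup>2 = v \<bullet> (\<Sum>i\<in>UNIV. (q i \<bullet> v) *\<^sub>R q i)"
    using expand[of v] by (simp add: power2_norm_eq_inner)
  then show ?thesis by (simp add: inner_sum_right inner_commute power2_eq_square)
qed

text \<open>Diagonal entries are values of the spectral form at the coordinate axes; after
  exchanging the sums, each eigenvalue is multiplied by the squared norm of a unit vector.\<close>

lemma trace_eq: "trace H = sum lam UNIV"
proof -
  have "H $ k $ k = (\<Sum>i\<in>UNIV. lam i * (q i $ k)\<^sup>2)" for k
  proof -
    have "H $ k $ k = axis k 1 \<bullet> (H *v axis k 1)"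
      by (simp add: inner_axis' matrix_vector_mult_basis column_def)
    then show ?thesis unfolding bilinear by (simp add: inner_axis power2_eq_square mult.assoc)
  qed
  then have "trace H = (\<Sum>k\<in>UNIV. \<Sum>i\<in>UNIV. lam i * (q i $ k)\<^sup>2)" by (simp add: trace_def)
  also have "\<dots> = (\<Sum>i\<in>UNIV. lam i * (\<Sum>k\<in>UNIV. (q i $ k)\<^sup>2))"
    by (subst sum.swap) (simp add: sum_distrib_left)
  also have "\<dots> = sum lam UNIV"
    using orthonormal[of i i for i] by (simp add: inner_vec_def power2_eq_square)
  finally show ?thesis .
qed

lemma eigenvalue_nonneg: "psd H \<Longrightarrow> 0 \<le> lam i"
  unfolding psd_def using eigen[of i] orthonormal[of i i] by (metis inner_scaleR_right mult.right_neutral)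

lemma eigenvalue_nonzero:
  assumes "H \<noteq> 0" shows "\<exists>i. lam i \<noteq> 0"
proof (rule ccontr)
  assume "\<not> (\<exists>i. lam i \<noteq> 0)"
  then have "H *v v = 0 *v v" for v by (simp add: mult_expand)
  then show False using assms matrix_eq by blast
qed

text \<open>Central differences are exact on quadratics: the constant and the terms of second order
  in \<open>mu\<close> cancel, leaving the directional derivative independently of
  \<open>mu\<close>.\<close>

lemma quad_difference:
  assumes "mu \<noteq> 0"
  shows "(f_quad f xs H (x + mu *\<^sub>R u) - f_quad f xs H (x - mu *\<^sub>R u)) / (2 * mu)
    = (\<Sum>j\<in>UNIV. lam j * (q j \<bullet> (x - xs)) * (q j \<bullet> u))"
proof -
  have "f_quad f xs H (x + mu *\<^sub>R u) - f_quad f xs H (x - mu *\<^sub>R u)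
      = 1/2 * (\<Sum>j\<in>UNIV. lam j * (q j \<bullet> (x + mu *\<^sub>R u - xs)) * (q j \<bullet> (x + mu *\<^sub>R u - xs))
          - lam j * (q j \<bullet> (x - mu *\<^sub>R u - xs)) * (q j \<bullet> (x - mu *\<^sub>R u - xs)))"
    unfolding f_quad_def bilinear sum_subtractf by (simp add: algebra_simps)
  also have "\<dots> = 1/2 * (\<Sum>j\<in>UNIV. (4 * mu) * (lam j * (q j \<bullet> (x - xs)) * (q j \<bullet> u)))"
    by (intro arg_cong[where f="\<lambda>s. 1/2 * s"] sum.cong refl)
      (simp add: inner_add_right inner_diff_right algebra_simps)
  also have "\<dots> = 2 * mu * (\<Sum>j\<in>UNIV. lam j * (q j \<bullet> (x - xs)) * (q j \<bullet> u))"
    unfolding sum_distrib_left[symmetric] by simp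
  finally show ?thesis using assms by simp
qed

text \<open>An iterate is its predecessor minus \<open>eta\<close> times the new momentum, so adding
  that multiple back recovers the previous error, and the momentum contribution becomes
  \<open>beta\<close> times the difference of the two errors. Zero initial momentum makes both
  errors agree at time zero.\<close>

lemma eigen_process_iterate:
  assumes "mu \<noteq> 0"
  shows "eigen_process q lam eta beta (\<lambda>i. q i \<bullet> (x0 - xs))
    (\<lambda>t i \<omega>. q i \<bullet> (iterate (f_quad f xs H) eta beta mu x0 t \<omega> - xs))
    (\<lambda>t i \<omega>. q i \<bullet> (iterate (f_quad f xs H) eta beta mu x0 t \<omega> - xs)
       + eta * (q i \<bullet> snd (zo_gdm (f_quad f xs H) eta beta mu x0 (gauss_dirs \<omega>) t)))"
proof -
  have z_step: "q i \<bullet> (x - eta *\<^sub>R (beta *\<^sub>R m + G *\<^sub>R u) - xs)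
      = (1 + beta) * (q i \<bullet> (x - xs)) - beta * (q i \<bullet> (x - xs) + eta * (q i \<bullet> m)) - eta * ((q i \<bullet> u) * G)"
    and y_step: "(1 + beta) * (q i \<bullet> (x - xs)) - beta * (q i \<bullet> (x - xs) + eta * (q i \<bullet> m)) - eta * ((q i \<bullet> u) * G)
      + eta * (q i \<bullet> (beta *\<^sub>R m + G *\<^sub>R u))
      = q i \<bullet> (x - xs)" for i x m u and G :: real
    by (simp_all add: inner_add_right inner_diff_right algebra_simps)
  show ?thesis
    by unfold_locales
      (simp_all only: iterate_def zo_gdm.simps Let_def fst_conv snd_conv orthonormal quad_difference[OF assms]
        z_step y_step inner_zero_right mult_zero_right add_0_right)
qed

end

lemma eigenbasis_exists:
  fixes H :: "real^'n^'n"
  assumes "eigenvalues_with_mult H lam"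
  obtains q where "eigenbasis H lam q"
proof -
  obtain Q where Q: "orthogonal_matrix Q" and ev: "\<And>i. H *v column i Q = lam i *\<^sub>R column i Q"
    using assms unfolding eigenvalues_with_mult_def by blast
  have "eigenbasis H lam (\<lambda>i. column i Q)"
  proof
    show "column i Q \<bullet> column j Q = (if i = j then 1 else 0)" for i j
      using Q unfolding orthogonal_matrix_orthonormal_columns by (auto simp: orthogonal_def norm_eq_1)
    show "v = (\<Sum>i\<in>UNIV. (column i Q \<bullet> v) *\<^sub>R column i Q)" for v
    proof -
      have "v = Q *v (transpose Q *v v)"
        using Q by (simp only: orthogonal_matrix_def matrix_vector_mul_assoc matrix_vector_mul_lid)
      also have "\<dots> = (\<Sum>i\<in>UNIV. (transpose Q *v v) $ i *\<^sub>R column i Q)"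
        by (simp add: matrix_mult_sum scalar_mult_eq_scaleR)
      also have "\<dots> = (\<Sum>i\<in>UNIV. (column i Q \<bullet> v) *\<^sub>R column i Q)"
        by (simp only: matrix_vector_mul_component) (simp add: transpose_def column_def)
      finally show ?thesis .
    qed
  qed (rule ev)
  then show ?thesis using that by blast
qed

section \<open>Critical step sizes\<close>

lemma (in eigen_process) second_moments:
  assumes "0 \<le> beta" "beta < 1" "0 \<le> eta" "\<And>i. 0 \<le> lam i"
  shows "second_moments (\<lambda>i. eta * lam i) beta Ezz Ezy Eyy"
  by unfold_locales (use assms in \<open>auto simp: Ezz_Suc Ezy_Suc Eyy_Suc quadratic_moment_nonneg\<close>)

section \<open>Boundedness of the error in mean and in mean square\<close>

context eigenbasis
begin

context
  fixes f :: "real^'n \<Rightarrow> real" and xs :: "real^'n" and beta mu :: real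
  assumes beta: "0 \<le> beta" "beta < 1" and mu: "mu \<noteq> 0"
    and lam_nonneg: "\<And>i. 0 \<le> lam i" and lam_max_pos: "0 < Max (range lam)"
begin

abbreviation (input) "err eta x0 t \<omega> \<equiv> iterate (f_quad f xs H) eta beta mu x0 t \<omega> - xs"

lemma lam_le_Max: "lam i \<le> Max (range lam)"
  by simp

lemma mean_error_bounded:
  assumes "0 < eta" "eta * Max (range lam) < 2 * (1 + beta)"
  shows "\<exists>B. \<forall>t. norm (\<integral>\<omega>. err eta x0 t \<omega> \<partial>gauss_space) \<le> B"
proof -
  interpret eigen_process q lam eta beta "\<lambda>i. q i \<bullet> (x0 - xs)" "\<lambda>t i \<omega>. q i \<bullet> err eta x0 t \<omega>"
    "\<lambda>t i \<omega>. q i \<bullet> err eta x0 t \<omega>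
       + eta * (q i \<bullet> snd (zo_gdm (f_quad f xs H) eta beta mu x0 (gauss_dirs \<omega>) t))"
    by (rule eigen_process_iterate[OF mu])
  have "\<exists>B. \<forall>t. \<bar>Ez t i\<bar> \<le> B" for i
  proof (rule heavy_ball_bounded[where n="\<lambda>t. Ey t i"])
    show "eta * lam i < 2 * (1 + beta)"
      using assms lam_le_Max[of i] by (smt (verit) mult_left_mono)
  qed (simp_all add: Ez_Suc Ey_Suc moments_0 beta assms lam_nonneg less_imp_le)
  then obtain B where B: "\<And>t i. \<bar>Ez t i\<bar> \<le> B i" by metis
  have "(\<integral>\<omega>. err eta x0 t \<omega> \<partial>gauss_space) = (\<Sum>i\<in>UNIV. Ez t i *\<^sub>R q i)" for t
  proof -
    have "(\<integral>\<omega>. err eta x0 t \<omega> \<partial>gauss_space) = (\<integral>\<omega>. (\<Sum>i\<in>UNIV. (q i \<bullet> err eta x0 t \<omega>) *\<^sub>R q i) \<partial>gauss_space)"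
      by (rule Bochner_Integration.integral_cong) (auto intro: expand)
    also have "\<dots> = (\<Sum>i\<in>UNIV. \<integral>\<omega>. (q i \<bullet> err eta x0 t \<omega>) *\<^sub>R q i \<partial>gauss_space)"
      by (rule Bochner_Integration.integral_sum) (auto intro: integrable_scaleR_left z_integrable)
    finally show ?thesis
      by (simp add: Ez_def z_integrable)
  qed
  moreover have "norm (\<Sum>i\<in>UNIV. Ez t i *\<^sub>R q i) \<le> sum B UNIV" for t
  proof (rule sum_norm_le)
    have "norm (q i) = 1" for i using orthonormal[of i i] by (simp add: norm_eq_1)
    then show "norm (Ez t i *\<^sub>R q i) \<le> B i" for i using B by simp
  qed
  ultimately show ?thesis by metis
qed

text \<open>A start displaced along a leading eigenvector gives that coordinate's mean the initial
  value one; its unbounded growth passes to the vector mean by Cauchy-Schwarz.\<close>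

lemma mean_error_unbounded:
  assumes "2 * (1 + beta) < eta * Max (range lam)"
  shows "\<exists>x0. \<not> (\<exists>B. \<forall>t. norm (\<integral>\<omega>. err eta x0 t \<omega> \<partial>gauss_space) \<le> B)"
proof -
  obtain k where k: "lam k = Max (range lam)" using Max_range_attained by metis
  define x0 where "x0 = xs + q k"
  interpret eigen_process q lam eta beta "\<lambda>i. q i \<bullet> (x0 - xs)" "\<lambda>t i \<omega>. q i \<bullet> err eta x0 t \<omega>"
    "\<lambda>t i \<omega>. q i \<bullet> err eta x0 t \<omega>
       + eta * (q i \<bullet> snd (zo_gdm (f_quad f xs H) eta beta mu x0 (gauss_dirs \<omega>) t))"
    by (rule eigen_process_iterate[OF mu])
  have unb: "\<not> (\<exists>B. \<forall>t. \<bar>Ez t k\<bar> \<le> B)"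
  proof (rule heavy_ball_unbounded[where n="\<lambda>t. Ey t k"])
    show "Ez 0 k = 1" "Ey 0 k = 1" using moments_0[of k] orthonormal[of k k] by (simp_all add: x0_def)
  qed (use beta assms k in \<open>simp_all add: Ez_Suc Ey_Suc\<close>)
  have "\<bar>Ez t k\<bar> \<le> norm (\<integral>\<omega>. err eta x0 t \<omega> \<partial>gauss_space)" for t
  proof -
    \<comment> \<open>Needed before the inner product may be moved inside: the integral of a
      non-integrable function is zero by convention.\<close>
    have int: "integrable gauss_space (\<lambda>\<omega>. err eta x0 t \<omega>)"
    proof -
      have "integrable gauss_space (\<lambda>\<omega>. \<Sum>i\<in>UNIV. (q i \<bullet> err eta x0 t \<omega>) *\<^sub>R q i)"
        by (intro Bochner_Integration.integrable_sum integrable_scaleR_left z_integrable)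
      then show ?thesis unfolding expand[symmetric] .
    qed
    have "Ez t k = q k \<bullet> (\<integral>\<omega>. err eta x0 t \<omega> \<partial>gauss_space)"
      unfolding Ez_def using int by simp
    then show ?thesis
      using Cauchy_Schwarz_ineq2[of "q k" "\<integral>\<omega>. err eta x0 t \<omega> \<partial>gauss_space"] orthonormal[of k k]
      by (simp add: norm_eq_1[THEN iffD2])
  qed
  then show ?thesis using unb by (meson order_trans)
qed

lemma crit_mean_eq:
  "crit_mean (f_quad f xs H) xs beta mu = 2 * (1 + beta) / Max (range lam)"
  unfolding crit_mean_def
proof (rule Sup_eq_threshold)
  show "0 < 2 * (1 + beta) / Max (range lam)" using beta lam_max_pos by simp
next
  fix eta assume "0 < eta" "eta < 2 * (1 + beta) / Max (range lam)"
  then show "eta \<in> {eta. eta > 0 \<and> (\<forall>x0. \<exists>B. \<forall>t. norm (\<integral>\<omega>. err eta x0 t \<omega> \<partial>gauss_space) \<le> B)}"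
    using mean_error_bounded lam_max_pos by (simp add: pos_less_divide_eq)
next
  fix eta assume "eta \<in> {eta. eta > 0 \<and> (\<forall>x0. \<exists>B. \<forall>t. norm (\<integral>\<omega>. err eta x0 t \<omega> \<partial>gauss_space) \<le> B)}"
  then have "\<not> 2 * (1 + beta) < eta * Max (range lam)" using mean_error_unbounded by blast
  then show "eta \<le> 2 * (1 + beta) / Max (range lam)" using lam_max_pos by (simp add: pos_le_divide_eq)
qed

text \<open>By Parseval the mean-square error is the sum of the \<open>Ezz t i\<close>, each bounded
  below the threshold.\<close>

lemma ms_error_bounded:
  assumes "0 < eta" "eta * Max (range lam) < 1 - beta\<^sup>2"
    "(\<Sum>i\<in>UNIV. eta * lam i / (2 * (1 - beta) * (1 - eta * lam i / (1 - beta\<^sup>2)))) < 1"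
  shows "(SUP t. \<integral>\<^sup>+\<omega>. ennreal ((norm (err eta x0 t \<omega>))\<^sup>2) \<partial>gauss_space) < \<infinity>"
proof -
  interpret eigen_process q lam eta beta "\<lambda>i. q i \<bullet> (x0 - xs)" "\<lambda>t i \<omega>. q i \<bullet> err eta x0 t \<omega>"
    "\<lambda>t i \<omega>. q i \<bullet> err eta x0 t \<omega>
       + eta * (q i \<bullet> snd (zo_gdm (f_quad f xs H) eta beta mu x0 (gauss_dirs \<omega>) t))"
    by (rule eigen_process_iterate[OF mu])
  interpret second_moments "\<lambda>i. eta * lam i" beta Ezz Ezy Eyy
    by (rule second_moments) (use assms beta lam_nonneg in auto)
  have "\<exists>B. \<forall>t. Ezz t i \<le> B" for i
  proof (rule bounded_below_threshold)
    show "eta * lam i < 1 - beta\<^sup>2" for i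
      using assms lam_le_Max[of i] by (smt (verit) mult_left_mono)
  qed (use assms in \<open>simp add: w_def\<close>)
  then obtain B where B: "\<And>t i. Ezz t i \<le> B i" by metis
  have "(\<integral>\<^sup>+\<omega>. ennreal ((norm (err eta x0 t \<omega>))\<^sup>2) \<partial>gauss_space) \<le> ennreal (sum B UNIV)" for t
  proof -
    have "(\<integral>\<^sup>+\<omega>. ennreal ((norm (err eta x0 t \<omega>))\<^sup>2) \<partial>gauss_space) = ennreal (\<Sum>i\<in>UNIV. Ezz t i)"
      unfolding norm_square Ezz_def
      by (subst nn_integral_eq_integral)
        (auto simp: z_square_integrable sum_nonneg intro!: Bochner_Integration.integrable_sum)
    then show ?thesis using B by (simp add: ennreal_leI sum_mono)
  qed
  then have "(SUP t. \<integral>\<^sup>+\<omega>. ennreal ((norm (err eta x0 t \<omega>))\<^sup>2) \<partial>gauss_space) \<le> ennreal (sum B UNIV)"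
    by (rule SUP_least)
  then show ?thesis by (rule order_le_less_trans) simp
qed

lemma ms_error_unbounded:
  assumes "0 < eta" "1 - beta\<^sup>2 \<le> eta * Max (range lam) \<or>
    1 < (\<Sum>i\<in>UNIV. eta * lam i / (2 * (1 - beta) * (1 - eta * lam i / (1 - beta\<^sup>2))))"
  shows "\<exists>x0. \<not> (SUP t. \<integral>\<^sup>+\<omega>. ennreal ((norm (err eta x0 t \<omega>))\<^sup>2) \<partial>gauss_space) < \<infinity>"
proof -
  obtain k where k: "lam k = Max (range lam)" using Max_range_attained by metis
  define x0 where "x0 = xs + q k"
  interpret eigen_process q lam eta beta "\<lambda>i. q i \<bullet> (x0 - xs)" "\<lambda>t i \<omega>. q i \<bullet> err eta x0 t \<omega>"
    "\<lambda>t i \<omega>. q i \<bullet> err eta x0 t \<omega>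
       + eta * (q i \<bullet> snd (zo_gdm (f_quad f xs H) eta beta mu x0 (gauss_dirs \<omega>) t))"
    by (rule eigen_process_iterate[OF mu])
  interpret second_moments "\<lambda>i. eta * lam i" beta Ezz Ezy Eyy
    by (rule second_moments) (use assms beta lam_nonneg in auto)
  have unb: "\<not> (\<exists>B. \<forall>t i. Ezz t i \<le> B)"
  proof (rule unbounded_above_threshold)
    show "Ezz 0 i = (if i = k then 1 else 0)" "Ezy 0 i = (if i = k then 1 else 0)"
      "Eyy 0 i = (if i = k then 1 else 0)" for i
      using moments_0[of i] orthonormal[of i k] by (simp_all add: x0_def)
    show "eta * lam i \<le> eta * lam k" for i using assms k lam_le_Max[of i] by simp
  qed (use assms k lam_max_pos in \<open>auto simp: w_def\<close>)
  have "\<not> (SUP t. \<integral>\<^sup>+\<omega>. ennreal ((norm (err eta x0 t \<omega>))\<^sup>2) \<partial>gauss_space) < \<infinity>"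
  proof
    assume "(SUP t. \<integral>\<^sup>+\<omega>. ennreal ((norm (err eta x0 t \<omega>))\<^sup>2) \<partial>gauss_space) < \<infinity>"
    then obtain B where B: "0 \<le> B"
      "(SUP t. \<integral>\<^sup>+\<omega>. ennreal ((norm (err eta x0 t \<omega>))\<^sup>2) \<partial>gauss_space) = ennreal B"
      unfolding infinity_ennreal_def less_top_ennreal by blast
    have "Ezz t i \<le> B" for t i
    proof -
      have "ennreal (Ezz t i) = (\<integral>\<^sup>+\<omega>. ennreal ((q i \<bullet> err eta x0 t \<omega>)\<^sup>2) \<partial>gauss_space)"
        unfolding Ezz_def by (subst nn_integral_eq_integral) (auto simp: z_square_integrable)
      also have "\<dots> \<le> (\<integral>\<^sup>+\<omega>. ennreal ((norm (err eta x0 t \<omega>))\<^sup>2) \<partial>gauss_space)"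
        unfolding norm_square by (intro nn_integral_mono ennreal_leI member_le_sum) auto
      also have "\<dots> \<le> ennreal B"
        unfolding B(2)[symmetric] by (rule SUP_upper) simp
      finally show ?thesis using B(1) by simp
    qed
    then show False using unb by blast
  qed
  then show ?thesis by blast
qed

text \<open>Strict monotonicity of the threshold sum places smaller step sizes on the stable side of
  the root \<open>e\<close> and larger ones on the unstable side.\<close>

lemma crit_ms_eq:
  assumes "0 < e" "e * Max (range lam) < 1 - beta\<^sup>2"
    "(\<Sum>i\<in>UNIV. e * lam i / (2 * (1 - beta) * (1 - e * lam i / (1 - beta\<^sup>2)))) = 1"
  shows "crit_ms (f_quad f xs H) xs beta mu = e"
  unfolding crit_ms_def
proof (rule Sup_eq_threshold)
  note mono = ms_sum_strict_mono[OF lam_nonneg lam_max_pos beta]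
  let ?A = "{eta. eta > 0 \<and> (\<forall>x0. (SUP t. \<integral>\<^sup>+\<omega>. ennreal ((norm (err eta x0 t \<omega>))\<^sup>2) \<partial>gauss_space) < \<infinity>)}"
  show "eta \<in> ?A" if "0 < eta" "eta < e" for eta
  proof -
    have "eta * Max (range lam) < 1 - beta\<^sup>2"
      using that assms lam_max_pos by (smt (verit) mult_right_mono)
    then show ?thesis
      using ms_error_bounded[of eta] mono[of eta e] that assms by auto
  qed
  show "eta \<le> e" if "eta \<in> ?A" for eta
  proof (rule ccontr)
    assume "\<not> eta \<le> e"
    then have "e < eta" by simp
    \<comment> \<open>Monotonicity is available only before the first pole; step sizes at or beyond
      it fall under the first disjunct.\<close>
    have "1 - beta\<^sup>2 \<le> eta * Max (range lam) \<or>
      1 < (\<Sum>i\<in>UNIV. eta * lam i / (2 * (1 - beta) * (1 - eta * lam i / (1 - beta\<^sup>2))))"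
      using mono[OF less_imp_le[OF assms(1)] \<open>e < eta\<close>] unfolding assms(3)
      by (cases "1 - beta\<^sup>2 \<le> eta * Max (range lam)") (simp_all only: not_le simp_thms)
    then show False using ms_error_unbounded[of eta] that by blast
  qed
qed (rule assms)

end

end

theorem theorem4p9:
  fixes f :: "real^'n \<Rightarrow> real" and xs :: "real^'n" and H :: "real^'n^'n"
    and lam :: "'n \<Rightarrow> real" and beta mu :: real
  assumes "local_minimizer f xs"
    and "twice_diff_near_with_hessian f xs H"
    and "psd H" and "H \<noteq> 0"
    and "eigenvalues_with_mult H lam"
    and "0 \<le> beta" and "beta < 1" and "mu > 0"
  shows "crit_mean (f_quad f xs H) xs beta mu = 2 * (1 + beta) / Max (range lam)
    \<and> (let e = crit_ms (f_quad f xs H) xs beta mu;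
           P = (\<lambda>eta. eta * Max (range lam) < 1 - beta\<^sup>2 \<and>
                 (\<Sum>i\<in>UNIV. eta * lam i / (2 * (1 - beta) * (1 - eta * lam i / (1 - beta\<^sup>2)))) = 1)
       in e > 0 \<and> P e \<and> (\<forall>eta>0. P eta \<longrightarrow> eta = e)
          \<and> 2 * (1 - beta) / (trace H + 2 * Max (range lam) / (1 + beta)) \<le> e
          \<and> e \<le> 2 * (1 - beta) / trace H)"
proof -
  obtain q where "eigenbasis H lam q" using eigenbasis_exists assms(5) by blast
  then interpret eigenbasis H lam q .
  have nonneg: "\<And>i. 0 \<le> lam i" using eigenvalue_nonneg assms(3) by blast
  have max_pos: "0 < Max (range lam)"
  proof -
    obtain i where "lam i \<noteq> 0" using eigenvalue_nonzero assms(4) by blast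
    then have "0 < lam i" using nonneg[of i] by simp
    also have "\<dots> \<le> Max (range lam)" by simp
    finally show ?thesis .
  qed
  have mu: "mu \<noteq> 0" using assms(8) by simp
  obtain e where e: "0 < e" "e * Max (range lam) < 1 - beta\<^sup>2"
    "(\<Sum>i\<in>UNIV. e * lam i / (2 * (1 - beta) * (1 - e * lam i / (1 - beta\<^sup>2)))) = 1"
    using ms_sum_root_exists[OF nonneg max_pos assms(6,7)] by blast
  note crit_ms = crit_ms_eq[OF assms(6,7) mu nonneg max_pos]
  note bounds = ms_sum_root_bounds[OF nonneg max_pos assms(6,7) e]
  \<comment> \<open>Every root equals the same supremum by \<open>crit_ms_eq\<close>, so two roots
    coincide.\<close>
  have unique: "eta = e" if "0 < eta" "eta * Max (range lam) < 1 - beta\<^sup>2"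
    "(\<Sum>i\<in>UNIV. eta * lam i / (2 * (1 - beta) * (1 - eta * lam i / (1 - beta\<^sup>2)))) = 1" for eta
    using crit_ms[OF that] crit_ms[OF e] by simp
  show ?thesis
    unfolding Let_def crit_ms[OF e] trace_eq
    using crit_mean_eq[OF assms(6,7) mu nonneg max_pos] e bounds unique by blast
qed

end
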